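(* Fix a tree partition of $\omega$. Assume the Continuum Hypothesis. Then the forcing notion $\mathbb Q_{\mathcal H}=(\mathcal H^+,\le_{\mathcal H})$ is forcing-equivalent to $(\mathcal P(\omega)/\mathrm{Fin})^+$.
   Context: A tree partition of $\omega$ is a family $\langle A_s:s\in\omega^{<\omega}\rangle$ of infinite subsets of $\omega$ such that $A_\varnothing=\omega$, for each $s$ the family $\{A_{s^\frown n}:n\in\omega\}$ is a partition of $A_s$, and any two distinct points of $\omega$ lie in different cells $A_s\neq A_t$ with $|s|=|t|=n$ for some $n$. For $X\subseteq\omega$ let $T^\infty_X=\{s\in\omega^{<\omega}:X\cap A_s\text{ is infinite}\}$. For $T\subseteq\omega^{<\omega}$ put $\mathrm{Succ}_T(s)=\{n:s^\frown n\in T\}$ and $D(T)=\{s\in T:\mathrm{Succ}_T(s)\text{ is infinite}\}$; $D^0(T)=T$, $D^{\alpha+1}(T)=D(D^\alpha(T))$, $D^\lambda(T)=\bigcap_{\beta<\lambda}D^\beta(T)$ for limit $\lambda$. $\mathcal H=\bigcup_{\alpha<\omega_1}\{X\subseteq\omega:\varnothing\notin D^\alpha(T^\infty_X)\}$, a proper ideal on $\omega$. $\mathcal H^+=\mathcal P(\omega)\setminus\mathcal H$, and $X\le_{\mathcal H}Y\iff X\setminus Y\in\mathcal H$. $(\mathcal P(\omega)/\mathrm{Fin})^+$ is the set of nonzero elements of the Boolean algebra $\mathcal P(\omega)/\mathrm{Fin}$, ordered by the Boolean order. Two forcing notions are forcing-equivalent if they have isomorphic Boolean completions (equivalently, yield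 the same generic extensions). *)

theory Defs
  imports Complex_Main "HOL-Library.Disjoint_Sets"
begin

unbundle cardinal_syntax

section \<open>Tree partitions\<close>

text \<open>Finite sequences of natural numbers are lists; \<open>s @ [n]\<close> is the one-point extension of \<open>s\<close>.\<close>

definition tree_partition :: "(nat list \<Rightarrow> nat set) \<Rightarrow> bool" where
  "tree_partition A \<longleftrightarrow>
     (\<forall>s. infinite (A s)) \<and>
     A [] = UNIV \<and>
     (\<forall>s. disjoint_family (\<lambda>n. A (s @ [n])) \<and> (\<Union>n. A (s @ [n])) = A s) \<and>
     (\<forall>x y. x \<noteq> y \<longrightarrow>
        (\<exists>n s t. length s = n \<and> length t = n \<and> x \<in> A s \<and> y \<in> A t \<and> A s \<noteq> A t))"

definition T_inf :: "(nat list \<Rightarrow> nat set) \<Rightarrow> nat set \<Rightarrow> nat list set" where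
  "T_inf A X = {s. infinite (X \<inter> A s)}"

definition Succ_nodes :: "nat list set \<Rightarrow> nat list \<Rightarrow> nat set" where
  "Succ_nodes T s = {n. s @ [n] \<in> T}"

definition Der :: "nat list set \<Rightarrow> nat list set" where
  "Der T = {s \<in> T. infinite (Succ_nodes T s)}"


section \<open>The first uncountable ordinal and the iterated derivative\<close>

text \<open>The well-order \<open>omega1\<close> has order type the successor cardinal of \<open>\<aleph>\<^sub>0\<close>; the
  elements of its field play the role of the countable ordinals.\<close>

definition omega1 :: "nat set rel" where
  "omega1 = cardSuc natLeq"

definition omega1_succ :: "nat set \<Rightarrow> nat set" where
  "omega1_succ \<beta> = wo_rel.suc omega1 {\<beta>}"

definition Der_iter :: "nat list set \<Rightarrow> nat set \<Rightarrow> nat list set" where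
  "Der_iter T = wo_rel.worec omega1 (\<lambda>F \<alpha>.
     if underS omega1 \<alpha> = {} then T
     else if \<exists>\<beta>\<in>underS omega1 \<alpha>. \<alpha> = omega1_succ \<beta>
       then Der (F (THE \<beta>. \<beta> \<in> underS omega1 \<alpha> \<and> \<alpha> = omega1_succ \<beta>))
     else (\<Inter>\<beta>\<in>underS omega1 \<alpha>. F \<beta>))"

lemma card_order_omega1: "Card_order omega1"
  by (simp add: omega1_def cardSuc_Card_order natLeq_Card_order)

lemma wo_rel_omega1: "wo_rel omega1"
  using card_order_omega1 unfolding wo_rel_def card_order_on_def by blast

lemma omega1_AboveS_nonempty:
  assumes "\<beta> \<in> Field omega1"
  shows "AboveS omega1 {\<beta>} \<noteq> {}"
proof -
  have inf: "infinite (Field omega1)"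
    unfolding omega1_def
    using Cinfinite_cardSuc[of natLeq] natLeq_Card_order natLeq_cinfinite
    by (auto simp: cinfinite_def)
  obtain \<gamma> where "\<gamma> \<in> Field omega1" "\<beta> \<noteq> \<gamma>" "(\<beta>, \<gamma>) \<in> omega1"
    using infinite_Card_order_limit[OF card_order_omega1 inf assms] by blast
  then show ?thesis by (auto simp: AboveS_def)
qed

lemma omega1_succ_greater:
  assumes "\<beta> \<in> Field omega1"
  shows "\<beta> \<in> underS omega1 (omega1_succ \<beta>)"
  using wo_rel.suc_greater[OF wo_rel_omega1, of "{\<beta>}" \<beta>] omega1_AboveS_nonempty[OF assms] assms
  by (auto simp: omega1_succ_def underS_def)

lemma omega1_succ_least:
  assumes "\<beta> \<in> underS omega1 \<gamma>"
  shows "(omega1_succ \<beta>, \<gamma>) \<in> omega1"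
  unfolding omega1_succ_def
  by (rule wo_rel.suc_least_AboveS[OF wo_rel_omega1])
     (use assms in \<open>auto simp: AboveS_def underS_def Field_def\<close>)

lemma omega1_succ_inj:
  assumes "\<beta> \<in> Field omega1" "\<gamma> \<in> Field omega1" "omega1_succ \<beta> = omega1_succ \<gamma>"
  shows "\<beta> = \<gamma>"
proof (rule ccontr)
  have anti: "antisym omega1" by (rule wo_rel.ANTISYM[OF wo_rel_omega1])
  have *: False if "\<beta> \<in> underS omega1 \<gamma>" "\<gamma> \<in> Field omega1" "omega1_succ \<beta> = omega1_succ \<gamma>" for \<beta> \<gamma>
    using omega1_succ_least[OF that(1)] omega1_succ_greater[OF that(2)] that(3) anti
    by (auto simp: underS_def antisym_def)
  assume "\<beta> \<noteq> \<gamma>"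
  then have "\<beta> \<in> underS omega1 \<gamma> \<or> \<gamma> \<in> underS omega1 \<beta>"
    using wo_rel.TOTALS[OF wo_rel_omega1] assms by (auto simp: underS_def)
  then show False using * assms by metis
qed

lemma Der_iter_unfold:
  "Der_iter T \<alpha> =
     (if underS omega1 \<alpha> = {} then T
      else if \<exists>\<beta>\<in>underS omega1 \<alpha>. \<alpha> = omega1_succ \<beta>
        then Der (Der_iter T (THE \<beta>. \<beta> \<in> underS omega1 \<alpha> \<and> \<alpha> = omega1_succ \<beta>))
      else (\<Inter>\<beta>\<in>underS omega1 \<alpha>. Der_iter T \<beta>))"
proof -
  have the: "(THE \<beta>. \<beta> \<in> underS omega1 \<alpha> \<and> \<alpha> = omega1_succ \<beta>) \<in> underS omega1 \<alpha>"
    if "\<exists>\<beta>\<in>underS omega1 \<alpha>. \<alpha> = omega1_succ \<beta>" for \<alpha>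
  proof -
    have "\<exists>!\<beta>. \<beta> \<in> underS omega1 \<alpha> \<and> \<alpha> = omega1_succ \<beta>"
      using that omega1_succ_inj by (auto simp: underS_def Field_def)
    from theI'[OF this] show ?thesis by blast
  qed
  let ?H = "\<lambda>F \<alpha>.
     if underS omega1 \<alpha> = {} then T
     else if \<exists>\<beta>\<in>underS omega1 \<alpha>. \<alpha> = omega1_succ \<beta>
       then Der (F (THE \<beta>. \<beta> \<in> underS omega1 \<alpha> \<and> \<alpha> = omega1_succ \<beta>))
     else (\<Inter>\<beta>\<in>underS omega1 \<alpha>. F \<beta>)"
  have adm: "wo_rel.adm_wo omega1 ?H"
    unfolding wo_rel.adm_wo_def[OF wo_rel_omega1]
  proof (intro allI impI)
    fix F G :: "nat set \<Rightarrow> nat list set" and \<alpha>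
    assume eq: "\<forall>\<beta>\<in>underS omega1 \<alpha>. F \<beta> = G \<beta>"
    show "?H F \<alpha> = ?H G \<alpha>"
    proof (cases "\<exists>\<beta>\<in>underS omega1 \<alpha>. \<alpha> = omega1_succ \<beta>")
      case True
      then show ?thesis using eq the[OF True] by auto
    next
      case False
      then show ?thesis using eq by simp
    qed
  qed
  show ?thesis
    using fun_cong[OF wo_rel.worec_fixpoint[OF wo_rel_omega1 adm], of \<alpha>]
    unfolding Der_iter_def .
qed

lemma Der_iter_zero:
  assumes "underS omega1 \<alpha> = {}"
  shows "Der_iter T \<alpha> = T"
  using assms by (simp add: Der_iter_unfold)

lemma Der_iter_succ:
  assumes "\<beta> \<in> Field omega1"
  shows "Der_iter T (omega1_succ \<beta>) = Der (Der_iter T \<beta>)"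
proof -
  have m: "\<beta> \<in> underS omega1 (omega1_succ \<beta>)" by (rule omega1_succ_greater[OF assms])
  have "(THE \<gamma>. \<gamma> \<in> underS omega1 (omega1_succ \<beta>) \<and> omega1_succ \<beta> = omega1_succ \<gamma>) = \<beta>"
    using m omega1_succ_inj assms by (intro the_equality) (auto simp: underS_def Field_def)
  then show ?thesis using m by (subst Der_iter_unfold) auto
qed

lemma Der_iter_limit:
  assumes "underS omega1 \<alpha> \<noteq> {}" "\<And>\<beta>. \<beta> \<in> underS omega1 \<alpha> \<Longrightarrow> \<alpha> \<noteq> omega1_succ \<beta>"
  shows "Der_iter T \<alpha> = (\<Inter>\<beta>\<in>underS omega1 \<alpha>. Der_iter T \<beta>)"
  using assms by (subst Der_iter_unfold) auto


section \<open>The ideal and its forcing notion\<close>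

definition H_ideal :: "(nat list \<Rightarrow> nat set) \<Rightarrow> nat set set" where
  "H_ideal A = (\<Union>\<alpha>\<in>Field omega1. {X. [] \<notin> Der_iter (T_inf A X) \<alpha>})"

definition H_plus :: "(nat list \<Rightarrow> nat set) \<Rightarrow> nat set set" where
  "H_plus A = UNIV - H_ideal A"

definition le_H :: "(nat list \<Rightarrow> nat set) \<Rightarrow> nat set \<Rightarrow> nat set \<Rightarrow> bool" where
  "le_H A X Y \<longleftrightarrow> X - Y \<in> H_ideal A"


section \<open>The Boolean algebra of subsets of the natural numbers modulo finite sets\<close>

definition eq_fin :: "nat set \<Rightarrow> nat set \<Rightarrow> bool" where
  "eq_fin X Y \<longleftrightarrow> finite ((X - Y) \<union> (Y - X))"

lemma equivp_eq_fin: "equivp eq_fin"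
proof (rule equivpI)
  show "transp eq_fin"
  proof (rule transpI)
    fix X Y Z assume "eq_fin X Y" "eq_fin Y Z"
    moreover have "(X - Z) \<union> (Z - X) \<subseteq> ((X - Y) \<union> (Y - X)) \<union> ((Y - Z) \<union> (Z - Y))" by blast
    ultimately show "eq_fin X Z" unfolding eq_fin_def by (meson finite_UnI finite_subset)
  qed
qed (auto simp: eq_fin_def reflp_def symp_def Un_commute)

quotient_type pow_fin = "nat set" / eq_fin
  by (rule equivp_eq_fin)

instantiation pow_fin :: boolean_algebra
begin

lift_definition bot_pow_fin :: pow_fin is "{}" .

lift_definition top_pow_fin :: pow_fin is "UNIV" .

lift_definition inf_pow_fin :: "pow_fin \<Rightarrow> pow_fin \<Rightarrow> pow_fin" is "(\<inter>)"
proof -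
  fix X X' Y Y' assume "eq_fin X X'" "eq_fin Y Y'"
  then show "eq_fin (X \<inter> Y) (X' \<inter> Y')"
    using finite_subset[of "((X \<inter> Y) - (X' \<inter> Y')) \<union> ((X' \<inter> Y') - (X \<inter> Y))"
        "((X - X') \<union> (X' - X)) \<union> ((Y - Y') \<union> (Y' - Y))"]
    unfolding eq_fin_def by blast
qed

lift_definition sup_pow_fin :: "pow_fin \<Rightarrow> pow_fin \<Rightarrow> pow_fin" is "(\<union>)"
proof -
  fix X X' Y Y' assume "eq_fin X X'" "eq_fin Y Y'"
  then show "eq_fin (X \<union> Y) (X' \<union> Y')"
    using finite_subset[of "((X \<union> Y) - (X' \<union> Y')) \<union> ((X' \<union> Y') - (X \<union> Y))"
        "((X - X') \<union> (X' - X)) \<union> ((Y - Y') \<union> (Y' - Y))"]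
    unfolding eq_fin_def by blast
qed

lift_definition minus_pow_fin :: "pow_fin \<Rightarrow> pow_fin \<Rightarrow> pow_fin" is "(-)"
proof -
  fix X X' Y Y' assume "eq_fin X X'" "eq_fin Y Y'"
  then show "eq_fin (X - Y) (X' - Y')"
    using finite_subset[of "((X - Y) - (X' - Y')) \<union> ((X' - Y') - (X - Y))"
        "((X - X') \<union> (X' - X)) \<union> ((Y - Y') \<union> (Y' - Y))"]
    unfolding eq_fin_def by blast
qed

lift_definition uminus_pow_fin :: "pow_fin \<Rightarrow> pow_fin" is "uminus"
  unfolding eq_fin_def by (erule rev_finite_subset) blast

lift_definition less_eq_pow_fin :: "pow_fin \<Rightarrow> pow_fin \<Rightarrow> bool" is "\<lambda>X Y. finite (X - Y)"
proof -
  fix X X' Y Y' assume *: "eq_fin X X'" "eq_fin Y Y'"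
  then have f: "finite (((X - X') \<union> (X' - X)) \<union> ((Y - Y') \<union> (Y' - Y)))"
    unfolding eq_fin_def by blast
  have "X - Y \<subseteq> (X' - Y') \<union> (((X - X') \<union> (X' - X)) \<union> ((Y - Y') \<union> (Y' - Y)))"
    "X' - Y' \<subseteq> (X - Y) \<union> (((X - X') \<union> (X' - X)) \<union> ((Y - Y') \<union> (Y' - Y)))" by blast+
  then show "finite (X - Y) = finite (X' - Y')"
    using f by (meson finite_UnI finite_subset)
qed

definition less_pow_fin :: "pow_fin \<Rightarrow> pow_fin \<Rightarrow> bool" where
  "less_pow_fin a b \<longleftrightarrow> a \<le> b \<and> \<not> b \<le> a"

instance
proof
  fix x y z :: pow_fin
  show "x \<le> z" if "x \<le> y" "y \<le> z"
    using that
  proof transfer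
    fix X Y Z :: "nat set" assume "finite (X - Y)" "finite (Y - Z)"
    moreover have "X - Z \<subseteq> (X - Y) \<union> (Y - Z)" by blast
    ultimately show "finite (X - Z)" by (meson finite_UnI finite_subset)
  qed
  show "x \<le> inf y z" if "x \<le> y" "x \<le> z"
    using that by transfer (simp add: Diff_Int)
  show "sup y z \<le> x" if "y \<le> x" "z \<le> x"
    using that by transfer (simp add: Un_Diff)
  show "(x < y) = (x \<le> y \<and> \<not> y \<le> x)"
    by (rule less_pow_fin_def)
  show "x = y" if "x \<le> y" "y \<le> x"
    using that by transfer (simp add: eq_fin_def)
  show "sup x (inf y z) = inf (sup x y) (sup x z)"
    by transfer (simp only: Un_Int_distrib equivp_reflp[OF equivp_eq_fin])
  show "x - y = inf x (- y)"
    by transfer (simp only: Diff_eq equivp_reflp[OF equivp_eq_fin])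
  show "x \<le> x" "inf x y \<le> x" "inf x y \<le> y" "x \<le> sup x y" "y \<le> sup x y" "bot \<le> x" "x \<le> top"
    by (transfer, rule finite_subset[of _ "{}"]; blast)+
  show "inf x (- x) = bot" "sup x (- x) = top"
    by (transfer, simp only: Compl_disjoint Compl_partition equivp_reflp[OF equivp_eq_fin])+
qed

end


section \<open>Forcing equivalence\<close>

text \<open>A forcing notion is given by a carrier \<open>P\<close> and a preorder \<open>le\<close> on it, smaller conditions being
  stronger.  Its Boolean completion is the algebra, ordered by inclusion, of the regular open
  subsets in the topology whose open sets are the downward closed ones: the
  closure of a downward closed \<open>U\<close> is \<open>{q. \<exists>r\<in>U. le r q}\<close> and the interior of \<open>W\<close> is
  \<open>{p. \<forall>q. le q p \<longrightarrow> q \<in> W}\<close>.\<close>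

definition regular_open :: "'a set \<Rightarrow> ('a \<Rightarrow> 'a \<Rightarrow> bool) \<Rightarrow> 'a set \<Rightarrow> bool" where
  "regular_open P le U \<longleftrightarrow>
     U \<subseteq> P \<and>
     (\<forall>p\<in>U. \<forall>q\<in>P. le q p \<longrightarrow> q \<in> U) \<and>
     {p \<in> P. \<forall>q\<in>P. le q p \<longrightarrow> (\<exists>r\<in>U. le r q)} = U"

definition boolean_completion :: "'a set \<Rightarrow> ('a \<Rightarrow> 'a \<Rightarrow> bool) \<Rightarrow> 'a set set" where
  "boolean_completion P le = {U. regular_open P le U}"

definition completion_embedding :: "'a set \<Rightarrow> ('a \<Rightarrow> 'a \<Rightarrow> bool) \<Rightarrow> 'a \<Rightarrow> 'a set" where
  "completion_embedding P le p = {q \<in> P. \<forall>r\<in>P. le r q \<longrightarrow> (\<exists>s\<in>P. le s r \<and> le s p)}"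

definition completion_compl :: "'a set \<Rightarrow> ('a \<Rightarrow> 'a \<Rightarrow> bool) \<Rightarrow> 'a set \<Rightarrow> 'a set" where
  "completion_compl P le U = {p \<in> P. \<forall>q\<in>P. le q p \<longrightarrow> q \<notin> U}"

context
  fixes P :: "'a set" and le :: "'a \<Rightarrow> 'a \<Rightarrow> bool"
  assumes le_refl: "\<And>p. p \<in> P \<Longrightarrow> le p p"
    and le_trans: "\<And>p q r. \<lbrakk>p \<in> P; q \<in> P; r \<in> P; le p q; le q r\<rbrakk> \<Longrightarrow> le p r"
begin

lemma boolean_completion_iff:
  "U \<in> boolean_completion P le \<longleftrightarrow>
     U \<subseteq> P \<and> (\<forall>p\<in>U. \<forall>q\<in>P. le q p \<longrightarrow> q \<in> U) \<and>
     (\<forall>p\<in>P. (\<forall>q\<in>P. le q p \<longrightarrow> (\<exists>r\<in>U. le r q)) \<longrightarrow> p \<in> U)"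
proof -
  have "U \<subseteq> {p \<in> P. \<forall>q\<in>P. le q p \<longrightarrow> (\<exists>r\<in>U. le r q)}"
    if "U \<subseteq> P" "\<forall>p\<in>U. \<forall>q\<in>P. le q p \<longrightarrow> q \<in> U"
    using that le_refl by blast
  then show ?thesis
    unfolding boolean_completion_def regular_open_def mem_Collect_eq by blast
qed

text \<open>For a preorder, the regular open sets contain the empty set and the carrier, are closed
  under intersections, and have pseudocomplements satisfying the law of double negation; hence
  they form a complete Boolean algebra.  The carrier maps densely into it.\<close>

lemma empty_in_boolean_completion: "{} \<in> boolean_completion P le"
  unfolding boolean_completion_iff using le_refl by blast

lemma carrier_in_boolean_completion: "P \<in> boolean_completion P le"
  unfolding boolean_completion_iff by blast

lemma Inter_in_boolean_completion:
  assumes "\<U> \<subseteq> boolean_completion P le" "\<U> \<noteq> {}"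
  shows "\<Inter>\<U> \<in> boolean_completion P le"
proof -
  have U: "U \<subseteq> P" "\<And>p q. \<lbrakk>p \<in> U; q \<in> P; le q p\<rbrakk> \<Longrightarrow> q \<in> U"
      "\<And>p. \<lbrakk>p \<in> P; \<forall>q\<in>P. le q p \<longrightarrow> (\<exists>r\<in>U. le r q)\<rbrakk> \<Longrightarrow> p \<in> U"
    if "U \<in> \<U>" for U
    using that assms(1) boolean_completion_iff[of U] by blast+
  show ?thesis
    unfolding boolean_completion_iff
  proof (intro conjI ballI impI)
    show "\<Inter>\<U> \<subseteq> P" using assms(2) U(1) by blast
    show "q \<in> \<Inter>\<U>" if "p \<in> \<Inter>\<U>" "q \<in> P" "le q p" for p q
      using that U(2) by blast
    show "p \<in> \<Inter>\<U>" if "p \<in> P" "\<forall>q\<in>P. le q p \<longrightarrow> (\<exists>r\<in>\<Inter>\<U>. le r q)" for p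
    proof
      fix U assume "U \<in> \<U>"
      then show "p \<in> U" using U(3)[of U p] that by blast
    qed
  qed
qed

lemma compl_in_boolean_completion:
  assumes "U \<in> boolean_completion P le"
  shows "completion_compl P le U \<in> boolean_completion P le"
  unfolding boolean_completion_iff
proof (intro conjI ballI impI)
  show "completion_compl P le U \<subseteq> P" by (auto simp: completion_compl_def)
  show "q \<in> completion_compl P le U" if "p \<in> completion_compl P le U" "q \<in> P" "le q p" for p q
    using that le_trans[of _ q p] by (auto simp: completion_compl_def)
  show "p \<in> completion_compl P le U"
    if p: "p \<in> P" "\<forall>q\<in>P. le q p \<longrightarrow> (\<exists>r\<in>completion_compl P le U. le r q)" for p
    unfolding completion_compl_def
  proof (intro CollectI conjI ballI impI notI p(1))
    fix q assume q: "q \<in> P" "le q p" "q \<in> U"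
    then obtain r where r: "r \<in> completion_compl P le U" "le r q" using p by blast
    then have "r \<in> P" "r \<notin> U" using le_refl by (auto simp: completion_compl_def)
    then show False using assms q r(2) unfolding boolean_completion_iff by blast
  qed
qed

lemma compl_disjoint_iff:
  assumes "U \<in> boolean_completion P le" "V \<in> boolean_completion P le"
  shows "V \<inter> U = {} \<longleftrightarrow> V \<subseteq> completion_compl P le U"
proof -
  have "V \<subseteq> P" "\<And>p q. \<lbrakk>p \<in> V; q \<in> P; le q p\<rbrakk> \<Longrightarrow> q \<in> V"
    using assms(2) unfolding boolean_completion_iff by blast+
  then show ?thesis using le_refl unfolding completion_compl_def by blast
qed

lemma compl_compl:
  assumes "U \<in> boolean_completion P le"
  shows "completion_compl P le (completion_compl P le U) = U"
proof -
  have U: "U \<subseteq> P" "\<And>p q. \<lbrakk>p \<in> U; q \<in> P; le q p\<rbrakk> \<Longrightarrow> q \<in> U"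
      "\<And>p. \<lbrakk>p \<in> P; \<forall>q\<in>P. le q p \<longrightarrow> (\<exists>r\<in>U. le r q)\<rbrakk> \<Longrightarrow> p \<in> U"
    using assms unfolding boolean_completion_iff by blast+
  show ?thesis
  proof
    show "completion_compl P le (completion_compl P le U) \<subseteq> U"
    proof
      fix p assume p: "p \<in> completion_compl P le (completion_compl P le U)"
      then have "p \<in> P" by (simp add: completion_compl_def)
      moreover have "\<exists>r\<in>U. le r q" if "q \<in> P" "le q p" for q
        using p that unfolding completion_compl_def by blast
      ultimately show "p \<in> U" using U(3) by blast
    qed
    show "U \<subseteq> completion_compl P le (completion_compl P le U)"
      using U(1,2) le_refl unfolding completion_compl_def by blast
  qed
qed

lemma embedding_in_boolean_completion:
  assumes "p \<in> P"
  shows "completion_embedding P le p \<in> boolean_completion P le - {{}}"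
proof -
  let ?E = "completion_embedding P le p"
  have "p \<in> ?E"
    using assms le_refl unfolding completion_embedding_def by blast
  moreover have "?E \<in> boolean_completion P le"
    unfolding boolean_completion_iff
  proof (intro conjI ballI impI)
    show "?E \<subseteq> P" by (auto simp: completion_embedding_def)
    show "r \<in> ?E" if "q \<in> ?E" "r \<in> P" "le r q" for q r
      using that le_trans[of _ r q] by (auto simp: completion_embedding_def)
    show "q \<in> ?E" if q: "q \<in> P" "\<forall>r\<in>P. le r q \<longrightarrow> (\<exists>s\<in>?E. le s r)" for q
      unfolding completion_embedding_def
    proof (intro CollectI conjI ballI impI q(1))
      fix r assume r: "r \<in> P" "le r q"
      then obtain s where s: "s \<in> ?E" "le s r" using q by blast
      then have "s \<in> P" by (simp add: completion_embedding_def)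
      then obtain t where "t \<in> P" "le t s" "le t p"
        using s(1) le_refl unfolding completion_embedding_def by blast
      then show "\<exists>s\<in>P. le s r \<and> le s p"
        using le_trans[of t s r] s(2) \<open>s \<in> P\<close> r(1) by blast
    qed
  qed
  ultimately show ?thesis by blast
qed

lemma embedding_mono:
  assumes "p \<in> P" "q \<in> P" "le p q"
  shows "completion_embedding P le p \<subseteq> completion_embedding P le q"
proof
  fix r assume r: "r \<in> completion_embedding P le p"
  have "le s q" if "s \<in> P" "le s p" for s
    using le_trans[of s p q] that assms by blast
  then show "r \<in> completion_embedding P le q"
    using r unfolding completion_embedding_def by blast
qed

lemma embedding_incompatible:
  assumes "p \<in> P" "q \<in> P" "\<not> (\<exists>r\<in>P. le r p \<and> le r q)"
  shows "completion_embedding P le p \<inter> completion_embedding P le q = {}"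
proof (rule ccontr)
  assume "completion_embedding P le p \<inter> completion_embedding P le q \<noteq> {}"
  then obtain r where r: "r \<in> completion_embedding P le p" "r \<in> completion_embedding P le q"
    by blast
  then have "r \<in> P" by (simp add: completion_embedding_def)
  then obtain s where s: "s \<in> P" "le s r" "le s p"
    using r(1) le_refl unfolding completion_embedding_def by blast
  then obtain t where t: "t \<in> P" "le t s" "le t q"
    using r(2) unfolding completion_embedding_def by blast
  then show False using le_trans[of t s p] s assms by blast
qed

lemma embedding_dense:
  assumes "U \<in> boolean_completion P le" "U \<noteq> {}"
  shows "\<exists>p\<in>P. completion_embedding P le p \<subseteq> U"
proof -
  have U: "U \<subseteq> P" "\<And>p q. \<lbrakk>p \<in> U; q \<in> P; le q p\<rbrakk> \<Longrightarrow> q \<in> U"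
      "\<And>p. \<lbrakk>p \<in> P; \<forall>q\<in>P. le q p \<longrightarrow> (\<exists>r\<in>U. le r q)\<rbrakk> \<Longrightarrow> p \<in> U"
    using assms(1) unfolding boolean_completion_iff by blast+
  obtain p where p: "p \<in> U" using assms(2) by blast
  have "completion_embedding P le p \<subseteq> U"
  proof
    fix q assume q: "q \<in> completion_embedding P le p"
    show "q \<in> U"
    proof (rule U(3))
      show "q \<in> P" using q by (simp add: completion_embedding_def)
      show "\<forall>r\<in>P. le r q \<longrightarrow> (\<exists>s\<in>U. le s r)"
        using q U(2)[OF p] unfolding completion_embedding_def by blast
    qed
  qed
  then show ?thesis using p U(1) by blast
qed

end

text \<open>An isomorphism of Boolean algebras is the same as an isomorphism of their orders.\<close>

definition forcing_equivalent ::
  "'a set \<Rightarrow> ('a \<Rightarrow> 'a \<Rightarrow> bool) \<Rightarrow> 'b set \<Rightarrow> ('b \<Rightarrow> 'b \<Rightarrow> bool) \<Rightarrow> bool" where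
  "forcing_equivalent P leP Q leQ \<longleftrightarrow>
     (\<exists>f. bij_betw f (boolean_completion P leP) (boolean_completion Q leQ) \<and>
          (\<forall>U\<in>boolean_completion P leP. \<forall>V\<in>boolean_completion P leP.
             U \<subseteq> V \<longleftrightarrow> f U \<subseteq> f V))"


section \<open>The Continuum Hypothesis\<close>

definition Continuum_Hypothesis :: bool where
  "Continuum_Hypothesis \<longleftrightarrow> |UNIV :: nat set set| =o cardSuc natLeq"

end

theory Submission
  imports Defs "HOL-Library.Countable_Set_Type" "HOL-Library.Nat_Bijection"
begin

text \<open>Under the Continuum Hypothesis all nonempty forcing notions with at most continuum many conditions,
  in which countable descending sequences have lower bounds and below every condition there is
  an antichain of size continuum, are equivalent.  Index them by a well-order of type
  \<open>\<omega>\<^sub>1\<close> on the continuum.  By recursion on levels one builds a dense tree inside such a forcing notion: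
  the nodes at level \<open>a\<close> that continue a fixed branch form a maximal antichain of size continuum among the
  lower bounds of that branch, each node deciding the \<open>a\<close>-th condition.  Every branch of countable length has
  a lower bound, so every possible branch is continued and the shape of the tree does not depend on
  the forcing notion (\<open>full_width_tree_exists\<close>).  Two such trees identify dense parts of two
  forcing notions so that compatibility is preserved, which is enough for the regular open
  algebras to be isomorphic (\<open>forcing_equivalent_of_dense_families\<close>).

  It remains to verify the hypotheses for both forcing notions.  Both consist of the sets whose
  support is infinite: for \<open>Fin\<close> the support of \<open>X\<close> is \<open>X\<close> itself, for \<open>\<H>\<close> it is the set of those
  \<open>n\<close> for which \<open>X\<close> is positive in the cell \<open>A [n]\<close>.  A diagonal set taking its \<open>k\<close>-th block
  from the \<open>k\<close>-th member of a descending sequence is a lower bound of that sequence, and restricting a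
  set to the blocks in an almost disjoint family of subsets of its support gives a large
  antichain (\<open>sigma_closed_positive\<close>).  That \<open>\<H>\<close> has this form follows from the description of its
  positive sets by infinitely branching subtrees of \<open>T_inf A X\<close>: the intersection of all derivatives is
  already equal to its own derivative, since \<open>\<omega>\<^sub>1\<close> is regular (\<open>H_plus_iff\<close>).\<close>

section \<open>Preorders with the same compatibility pattern on a dense part\<close>

definition compatible :: "'a set \<Rightarrow> ('a \<Rightarrow> 'a \<Rightarrow> bool) \<Rightarrow> 'a \<Rightarrow> 'a \<Rightarrow> bool" where
  "compatible P le p q \<longleftrightarrow> (\<exists>r\<in>P. le r p \<and> le r q)"

lemma compatible_sym: "compatible P le p q \<Longrightarrow> compatible P le q p"
  by (auto simp: compatible_def)

locale forcing_notion =
  fixes P :: "'a set" and le :: "'a \<Rightarrow> 'a \<Rightarrow> bool"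
  assumes refl: "p \<in> P \<Longrightarrow> le p p"
    and trans: "\<lbrakk>p \<in> P; q \<in> P; r \<in> P; le p q; le q r\<rbrakk> \<Longrightarrow> le p r"
begin

lemma compatible_mono:
  assumes "compatible P le p q" "p \<in> P" "q \<in> P" "p' \<in> P" "q' \<in> P" "le p p'" "le q q'"
  shows "compatible P le p' q'"
  using assms trans unfolding compatible_def by blast

lemma completion_iff:
  "U \<in> boolean_completion P le \<longleftrightarrow>
     U \<subseteq> P \<and> (\<forall>p\<in>U. \<forall>q\<in>P. le q p \<longrightarrow> q \<in> U) \<and>
     (\<forall>p\<in>P. (\<forall>q\<in>P. le q p \<longrightarrow> (\<exists>r\<in>U. le r q)) \<longrightarrow> p \<in> U)"
  using boolean_completion_iff[of P le U] refl trans by blast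

lemma le_imp_compatible: "\<lbrakk>p \<in> P; le p q\<rbrakk> \<Longrightarrow> compatible P le p q"
  using refl unfolding compatible_def by blast

end

text \<open>These two maps set up the Galois connection of incompatibility between sets of conditions
  and sets of indices of a family \<open>F\<close>.  For a dense family the closed sets of conditions are exactly
  the regular open ones, so the regular open algebra can be read off from the indices.\<close>

definition polar_index :: "'a set \<Rightarrow> ('a \<Rightarrow> 'a \<Rightarrow> bool) \<Rightarrow> ('i \<Rightarrow> 'a) \<Rightarrow> 'a set \<Rightarrow> 'i set" where
  "polar_index P le F U = {i. \<forall>u\<in>U. \<not> compatible P le (F i) u}"

definition polar_of_index :: "'a set \<Rightarrow> ('a \<Rightarrow> 'a \<Rightarrow> bool) \<Rightarrow> ('i \<Rightarrow> 'a) \<Rightarrow> 'i set \<Rightarrow> 'a set" where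
  "polar_of_index P le F I = {p \<in> P. \<forall>i\<in>I. \<not> compatible P le (F i) p}"

locale dense_family = forcing_notion P le for P :: "'a set" and le +
  fixes F :: "'i \<Rightarrow> 'a"
  assumes in_P: "F i \<in> P"
    and dense: "p \<in> P \<Longrightarrow> \<exists>i. le (F i) p"
begin

lemma polar_of_index_in_completion:
  "polar_of_index P le F I \<in> boolean_completion P le"
  unfolding completion_iff
proof (intro conjI ballI impI)
  show "polar_of_index P le F I \<subseteq> P" by (auto simp: polar_of_index_def)
  show "q \<in> polar_of_index P le F I"
    if "p \<in> polar_of_index P le F I" "q \<in> P" "le q p" for p q
    using that compatible_mono[OF _ in_P _ in_P _ refl[OF in_P], of _ q p]
    by (auto simp: polar_of_index_def)
  show "p \<in> polar_of_index P le F I"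
    if p: "p \<in> P" "\<forall>q\<in>P. le q p \<longrightarrow> (\<exists>r\<in>polar_of_index P le F I. le r q)" for p
    unfolding polar_of_index_def
  proof (intro CollectI conjI ballI notI p(1))
    fix i assume i: "i \<in> I" "compatible P le (F i) p"
    then obtain s where s: "s \<in> P" "le s (F i)" "le s p" by (auto simp: compatible_def)
    then obtain r where r: "r \<in> polar_of_index P le F I" "le r s" using p by blast
    then have "r \<in> P" by (simp add: polar_of_index_def)
    then have "le r (F i)" using trans r(2) s in_P by blast
    then have "compatible P le (F i) r"
      using \<open>r \<in> P\<close> refl by (auto simp: compatible_def)
    then show False using r(1) i(1) by (auto simp: polar_of_index_def)
  qed
qed

text \<open>A condition outside a regular open \<open>U\<close> has an extension none of whose extensions lies in \<open>U\<close>,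
  and density puts a member of the family below that extension.\<close>

lemma polar_of_polar_index:
  assumes "U \<in> boolean_completion P le"
  shows "polar_of_index P le F (polar_index P le F U) = U"
proof
  have U: "U \<subseteq> P" "\<And>p q. \<lbrakk>p \<in> U; q \<in> P; le q p\<rbrakk> \<Longrightarrow> q \<in> U"
      "\<And>p. \<lbrakk>p \<in> P; \<forall>q\<in>P. le q p \<longrightarrow> (\<exists>r\<in>U. le r q)\<rbrakk> \<Longrightarrow> p \<in> U"
    using assms completion_iff[of U] by blast+
  show "U \<subseteq> polar_of_index P le F (polar_index P le F U)"
    using U(1) by (auto simp: polar_of_index_def polar_index_def)
  show "polar_of_index P le F (polar_index P le F U) \<subseteq> U"
  proof (rule subsetI, rule ccontr)
    fix p assume p: "p \<in> polar_of_index P le F (polar_index P le F U)" "p \<notin> U"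
    then have "p \<in> P" by (simp add: polar_of_index_def)
    then obtain q where q: "q \<in> P" "le q p" "\<not> (\<exists>r\<in>U. le r q)" using U(3) p(2) by blast
    obtain i where i: "le (F i) q" using dense q(1) by blast
    have "le (F i) p" using trans[OF in_P q(1) \<open>p \<in> P\<close> i q(2)] .
    then have "compatible P le (F i) p" using le_imp_compatible in_P by blast
    moreover have "i \<in> polar_index P le F U"
      unfolding polar_index_def
    proof (intro CollectI ballI notI)
      fix u assume u: "u \<in> U" "compatible P le (F i) u"
      then obtain r where r: "r \<in> P" "le r (F i)" "le r u" by (auto simp: compatible_def)
      then have "r \<in> U" using U(2) u(1) by blast
      moreover have "le r q" using trans[OF r(1) in_P q(1) r(2) i] .
      ultimately show False using q(3) by blast
    qed
    ultimately show False using p(1) by (auto simp: polar_of_index_def)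
  qed
qed

text \<open>Density reduces membership in the polar of \<open>U\<close> to incompatibility with the members of
  the family lying in \<open>U\<close>, which the index pattern can express.\<close>

lemma polar_index_eq:
  assumes "\<And>p q. \<lbrakk>p \<in> U; q \<in> P; le q p\<rbrakk> \<Longrightarrow> q \<in> U" "U \<subseteq> P"
  shows "polar_index P le F U = {i. \<forall>j. F j \<in> U \<longrightarrow> \<not> compatible P le (F i) (F j)}"
proof (intro equalityI subsetI CollectI)
  fix i assume "i \<in> polar_index P le F U"
  then show "\<forall>j. F j \<in> U \<longrightarrow> \<not> compatible P le (F i) (F j)"
    by (auto simp: polar_index_def)
next
  fix i assume i: "i \<in> {i. \<forall>j. F j \<in> U \<longrightarrow> \<not> compatible P le (F i) (F j)}"
  show "i \<in> polar_index P le F U"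
    unfolding polar_index_def
  proof (intro CollectI ballI notI)
    fix u assume u: "u \<in> U" "compatible P le (F i) u"
    then obtain r where r: "r \<in> P" "le r (F i)" "le r u" by (auto simp: compatible_def)
    obtain j where j: "le (F j) r" using dense r(1) by blast
    have "F j \<in> U" using assms(1)[OF assms(1)[OF u(1) r(1,3)] in_P j] .
    moreover have "compatible P le (F i) (F j)"
      using trans[OF in_P r(1) in_P j r(2)] le_imp_compatible[OF in_P] compatible_sym by metis
    ultimately show False using i by blast
  qed
qed

end

text \<open>The index sets that are polars of regular open sets are the same for both families, as they are
  determined by the compatibility pattern alone.\<close>

lemma polar_index_polar_of_index:
  assumes "dense_family P le F" "dense_family Q le' G"
    and pattern: "\<And>i j. compatible P le (F i) (F j) \<longleftrightarrow> compatible Q le' (G i) (G j)"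
    and U: "U \<in> boolean_completion P le"
  shows "polar_index Q le' G (polar_of_index Q le' G (polar_index P le F U)) = polar_index P le F U"
    (is "polar_index Q le' G ?V = ?I")
proof -
  interpret F: dense_family P le F by fact
  interpret G: dense_family Q le' G by fact
  have U': "U \<subseteq> P" "\<And>p q. \<lbrakk>p \<in> U; q \<in> P; le q p\<rbrakk> \<Longrightarrow> q \<in> U"
    using U F.completion_iff[of U] by blast+
  show ?thesis
  proof
    show "?I \<subseteq> polar_index Q le' G ?V"
      by (auto simp: polar_index_def polar_of_index_def)
    show "polar_index Q le' G ?V \<subseteq> ?I"
    proof
      fix i assume i: "i \<in> polar_index Q le' G ?V"
      have "\<forall>j. F j \<in> U \<longrightarrow> \<not> compatible P le (F i) (F j)"
      proof (intro allI impI)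
        fix j assume "F j \<in> U"
        then have "G j \<in> ?V"
          using G.in_P pattern by (auto simp: polar_of_index_def polar_index_def)
        then show "\<not> compatible P le (F i) (F j)" using i pattern by (auto simp: polar_index_def)
      qed
      moreover have "?I = {i. \<forall>j. F j \<in> U \<longrightarrow> \<not> compatible P le (F i) (F j)}"
        by (rule F.polar_index_eq) (use U' in blast)+
      ultimately show "i \<in> ?I" by blast
    qed
  qed
qed

text \<open>Passing from conditions to indices by the polar and back by the polar in the other forcing
  notion is the isomorphism: two polars cancel, on either side, and they are antitone.\<close>

theorem forcing_equivalent_of_dense_families:
  assumes "dense_family P le F" "dense_family Q le' G"
    and pattern: "\<And>i j. compatible P le (F i) (F j) \<longleftrightarrow> compatible Q le' (G i) (G j)"
  shows "forcing_equivalent P le Q le'"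
proof -
  interpret F: dense_family P le F by fact
  interpret G: dense_family Q le' G by fact
  define f where "f U = polar_of_index Q le' G (polar_index P le F U)" for U
  define g where "g V = polar_of_index P le F (polar_index Q le' G V)" for V
  have gf: "g (f U) = U" if "U \<in> boolean_completion P le" for U
    using polar_index_polar_of_index[OF assms that] F.polar_of_polar_index[OF that]
    by (simp add: f_def g_def)
  have fg: "f (g V) = V" if "V \<in> boolean_completion Q le'" for V
    using polar_index_polar_of_index[OF assms(2,1) pattern[symmetric] that]
      G.polar_of_polar_index[OF that]
    by (simp add: f_def g_def)
  have "bij_betw f (boolean_completion P le) (boolean_completion Q le')"
    by (rule bij_betw_byWitness[where f' = g])
      (auto simp: gf fg, auto simp: f_def g_def F.polar_of_index_in_completion
         G.polar_of_index_in_completion)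
  moreover have "f U \<subseteq> f V" if "U \<subseteq> V" for U V
    using that by (auto simp: f_def polar_of_index_def polar_index_def)
  moreover have "g U \<subseteq> g V" if "U \<subseteq> V" for U V
    using that by (auto simp: g_def polar_of_index_def polar_index_def)
  ultimately show ?thesis
    unfolding forcing_equivalent_def by (intro exI[of _ f]) (metis gf)
qed


section \<open>A dense tree of full width\<close>

text \<open>A well-order of type at most \<open>\<omega>\<^sub>1\<close>, given by its strict part.\<close>

locale omega1_index =
  fixes lt :: "'w \<Rightarrow> 'w \<Rightarrow> bool" (infix "\<prec>" 50)
  assumes wf_lt: "wfp (\<prec>)"
    and trans_lt: "\<lbrakk>a \<prec> b; b \<prec> c\<rbrakk> \<Longrightarrow> a \<prec> c"
    and total_lt: "a \<prec> b \<or> a = b \<or> b \<prec> a"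
    and countable_below: "countable {b. b \<prec> a}"

text \<open>A node of level \<open>a\<close> is named by the labels \<open>s b\<close> for \<open>b \<prec> a\<close> or \<open>b = a\<close>, where \<open>s\<close> is a total function:
  \<open>node_local\<close> says that its other values are irrelevant.  In this way levels at
  limit and at successor indices are treated alike, and every label sequence names a node.\<close>

locale full_width_tree = forcing_notion P le + omega1_index lt
  for P :: "'a set" and le and lt :: "'w \<Rightarrow> 'w \<Rightarrow> bool" (infix "\<prec>" 50) +
  fixes F :: "('w \<Rightarrow> 'w) \<Rightarrow> 'w \<Rightarrow> 'a"
  assumes node_in: "F s a \<in> P"
    and node_decreasing: "b \<prec> a \<Longrightarrow> le (F s a) (F s b)"
    and node_local: "(\<And>b. b \<prec> a \<or> b = a \<Longrightarrow> s b = t b) \<Longrightarrow> F s a = F t a"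
    and siblings_incompatible:
      "\<lbrakk>\<And>b. b \<prec> a \<Longrightarrow> s b = t b; s a \<noteq> t a\<rbrakk> \<Longrightarrow> \<not> compatible P le (F s a) (F t a)"
    and node_dense: "p \<in> P \<Longrightarrow> \<exists>s a. le (F s a) p"
begin

lemma node_mono: "b \<prec> a \<or> b = a \<Longrightarrow> le (F s a) (F s b)"
  using node_decreasing refl[OF node_in] by blast

text \<open>Compatibility of nodes is comparability of their names, whatever the forcing notion.  At the
  least index where two names differ the two nodes are siblings.\<close>

lemma node_compatible_iff:
  "compatible P le (F s a) (F t b) \<longleftrightarrow> (\<forall>c. (c \<prec> a \<or> c = a) \<and> (c \<prec> b \<or> c = b) \<longrightarrow> s c = t c)"
    (is "?C \<longleftrightarrow> (\<forall>c. ?D c \<longrightarrow> s c = t c)")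
proof
  assume C: ?C
  show "\<forall>c. ?D c \<longrightarrow> s c = t c"
  proof (rule ccontr)
    assume "\<not> ?thesis"
    then obtain c\<^sub>0 where "c\<^sub>0 \<in> {c. ?D c \<and> s c \<noteq> t c}" by blast
    then obtain c where "c \<in> {c. ?D c \<and> s c \<noteq> t c}"
      and "\<And>d. (d, c) \<in> {(b, a). b \<prec> a} \<Longrightarrow> d \<notin> {c. ?D c \<and> s c \<noteq> t c}"
      by (rule wfE_min[OF wf_lt[unfolded wfp_def]]) blast
    then have c: "?D c" "s c \<noteq> t c"
      and least: "\<And>d. d \<prec> c \<Longrightarrow> \<not> (?D d \<and> s d \<noteq> t d)" by auto
    have "s d = t d" if "d \<prec> c" for d
      using least[OF that] c(1) trans_lt that by blast
    then have "\<not> compatible P le (F s c) (F t c)" using siblings_incompatible c(2) by blast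
    then show False
      using compatible_mono[OF C node_in node_in node_in node_in] node_mono c(1) by blast
  qed
next
  have *: "compatible P le (F s a) (F t b)"
    if "a \<prec> b \<or> a = b" "\<And>c. c \<prec> a \<or> c = a \<Longrightarrow> s c = t c" for s t a b
  proof -
    have "F s a = F t a" using node_local that(2) by blast
    then show ?thesis
      using compatible_sym[OF le_imp_compatible[OF node_in node_mono[OF that(1), of t]]] by simp
  qed
  assume R: "\<forall>c. ?D c \<longrightarrow> s c = t c"
  show ?C
  proof (cases "a \<prec> b \<or> a = b")
    case True
    then have "c \<prec> b \<or> c = b" if "c \<prec> a \<or> c = a" for c
      using that trans_lt by blast
    then show ?thesis using *[OF True, of s t] R by blast
  next
    case False
    then have ba: "b \<prec> a \<or> b = a" using total_lt by blast
    then have "c \<prec> a \<or> c = a" if "c \<prec> b \<or> c = b" for c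
      using that trans_lt by blast
    then have "t c = s c" if "c \<prec> b \<or> c = b" for c
      using that R by simp
    then have "compatible P le (F t b) (F s a)" by (rule *[OF ba])
    then show ?thesis by (rule compatible_sym)
  qed
qed

lemma dense_family_nodes: "dense_family P le (\<lambda>(s, a). F s a)"
  by unfold_locales (use node_in node_dense in auto)

end

theorem forcing_equivalent_of_full_width_trees:
  assumes "full_width_tree P le lt F" "full_width_tree Q le' lt G"
  shows "forcing_equivalent P le Q le'"
proof -
  interpret F: full_width_tree P le lt F by fact
  interpret G: full_width_tree Q le' lt G by fact
  show ?thesis
    by (rule forcing_equivalent_of_dense_families[OF F.dense_family_nodes G.dense_family_nodes])
      (auto simp: F.node_compatible_iff G.node_compatible_iff)
qed

lemma full_width_tree_image:
  assumes "full_width_tree P le lt F"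
    and image: "h ` P = Q" and le: "\<And>p q. \<lbrakk>p \<in> P; q \<in> P\<rbrakk> \<Longrightarrow> le' (h p) (h q) \<longleftrightarrow> le p q"
  shows "full_width_tree Q le' lt (\<lambda>s a. h (F s a))"
proof -
  interpret full_width_tree P le lt F by fact
  have compat: "compatible Q le' (h p) (h q) \<longleftrightarrow> compatible P le p q" if "p \<in> P" "q \<in> P" for p q
    unfolding compatible_def image[symmetric] using le that by auto
  show ?thesis
  proof
    show "le' p p" if "p \<in> Q" for p using that le refl unfolding image[symmetric] by auto
    show "le' p r" if "p \<in> Q" "q \<in> Q" "r \<in> Q" "le' p q" "le' q r" for p q r
      using that le trans unfolding image[symmetric] by blast
    show "h (F s a) \<in> Q" for s a using node_in image by blast
    show "le' (h (F s a)) (h (F s b))" if "lt b a" for s a b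
      using le node_in node_decreasing[OF that] by blast
    show "h (F s a) = h (F t a)" if "\<And>b. lt b a \<or> b = a \<Longrightarrow> s b = t b" for s t a
      using node_local[of a s t] that by simp
    show "\<not> compatible Q le' (h (F s a)) (h (F t a))"
      if "\<And>b. lt b a \<Longrightarrow> s b = t b" "s a \<noteq> t a" for s t a
      using siblings_incompatible[of a s t] that compat node_in by simp
    show "\<exists>s a. le' (h (F s a)) p" if "p \<in> Q" for p
      using that node_dense le node_in unfolding image[symmetric] by blast
  qed
qed

text \<open>The type \<open>'w\<close> of indices also bounds the number of conditions and measures the antichains.  With
  the countability of its initial segments this is where the Continuum Hypothesis enters.\<close>

locale sigma_closed_forcing = forcing_notion P le + omega1_index lt
  for P :: "'a set" and le and lt :: "'w \<Rightarrow> 'w \<Rightarrow> bool" (infix "\<prec>" 50) +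
  assumes nonempty: "P \<noteq> {}"
    and closed: "\<lbrakk>\<And>n. x n \<in> P; \<And>n::nat. le (x (Suc n)) (x n)\<rbrakk> \<Longrightarrow> \<exists>y\<in>P. \<forall>n. le y (x n)"
    and splitting: "p \<in> P \<Longrightarrow> \<exists>c::'w \<Rightarrow> 'a. (\<forall>i. c i \<in> P \<and> le (c i) p) \<and>
           (\<forall>i j. i \<noteq> j \<longrightarrow> \<not> compatible P le (c i) (c j))"
    and enumerated: "\<exists>e::'w \<Rightarrow> 'a. P = range e"
begin

lemma countable_chain_bounded:
  assumes "countable B" "B \<subseteq> P" and chain: "\<And>p q. \<lbrakk>p \<in> B; q \<in> B\<rbrakk> \<Longrightarrow> le p q \<or> le q p"
  shows "\<exists>y\<in>P. \<forall>b\<in>B. le y b"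
proof (cases "B = {}")
  case True
  then show ?thesis using nonempty by blast
next
  case False
  then obtain b :: "nat \<Rightarrow> 'a" where b: "B = range b"
    using assms(1) range_from_nat_into by metis
  \<comment> \<open>The running minimum of the enumeration is a descending sequence with the same lower bounds.\<close>
  define x where "x = rec_nat (b 0) (\<lambda>n y. if le (b (Suc n)) y then b (Suc n) else y)"
  have xB: "x n \<in> B" for n by (induction n) (auto simp: x_def b)
  then have xP: "x n \<in> P" for n using assms(2) by blast
  have dec: "le (x (Suc n)) (x n)" for n
    using refl[OF xP[of n]] by (simp add: x_def)
  have below: "le (x n) (b n)" for n
  proof (cases n)
    case 0
    then show ?thesis using refl[OF xP[of 0]] by (simp add: x_def)
  next
    case (Suc m)
    have "le (b (Suc m)) (x m) \<or> le (x m) (b (Suc m))" using chain xB b by blast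
    then show ?thesis using refl assms(2) b Suc by (auto simp: x_def)
  qed
  obtain y where y: "y \<in> P" "\<And>n. le y (x n)" using closed[of x, OF xP dec] by blast
  have "le y (b n)" for n
    using trans[OF y(1) xP _ y(2) below] assms(2) b by blast
  then show ?thesis using y(1) b by blast
qed

text \<open>A maximal antichain, indexed by labels, among the lower bounds of \<open>B\<close>.  Each member lies
  below \<open>p\<close> or is incompatible with it; this will make the tree dense.\<close>

definition deciding_antichain :: "'a set \<Rightarrow> 'a \<Rightarrow> ('w \<Rightarrow> 'a) \<Rightarrow> bool" where
  "deciding_antichain B p e \<longleftrightarrow>
     (\<forall>i. e i \<in> P \<and> (\<forall>b\<in>B. le (e i) b) \<and> (le (e i) p \<or> \<not> compatible P le (e i) p)) \<and>
     (\<forall>i j. i \<noteq> j \<longrightarrow> \<not> compatible P le (e i) (e j)) \<and>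
     (\<forall>x\<in>P. (\<forall>b\<in>B. le x b) \<longrightarrow> (\<exists>i. compatible P le x (e i)))"

text \<open>The lower bounds of \<open>B\<close> that decide \<open>p\<close> are dense among all lower bounds, so a maximal antichain
  of deciding ones is predense.  Starting from an antichain of full size below one of them and
  extending it by Zorn's lemma makes its size exactly that of the index type.\<close>

lemma deciding_antichain_exists:
  assumes B: "\<exists>y\<in>P. \<forall>b\<in>B. le y b" and "B \<subseteq> P" and p: "p \<in> P"
  shows "\<exists>e. deciding_antichain B p e"
proof -
  define D where "D = {x\<in>P. (\<forall>b\<in>B. le x b) \<and> (le x p \<or> \<not> compatible P le x p)}"
  have lower: "le x b" if "x \<in> P" "y \<in> P" "le x y" "\<forall>b\<in>B. le y b" "b \<in> B" for x y b
    using trans that assms(2) by blast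
  have D_dense: "\<exists>d\<in>D. le d x" if x: "x \<in> P" "\<forall>b\<in>B. le x b" for x
  proof (cases "compatible P le x p")
    case True
    then obtain r where r: "r \<in> P" "le r x" "le r p" by (auto simp: compatible_def)
    then have "r \<in> D" using lower[OF r(1) x(1) r(2) x(2)] by (auto simp: D_def)
    then show ?thesis using r by blast
  next
    case False
    then have "x \<in> D" using x by (auto simp: D_def)
    then show ?thesis using refl x(1) by blast
  qed
  have D_down: "y \<in> D" if "x \<in> D" "y \<in> P" "le y x" for x y
    using that lower[of y x] trans[of y x p] p compatible_mono[of y p x p] refl[OF p]
    by (auto simp: D_def)
  obtain d where d: "d \<in> D" using D_dense B by blast
  then have "d \<in> P" by (simp add: D_def)
  then obtain c :: "'w \<Rightarrow> 'a" where c: "\<And>i. c i \<in> P" "\<And>i. le (c i) d"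
      "\<And>i j. i \<noteq> j \<Longrightarrow> \<not> compatible P le (c i) (c j)"
    using splitting by metis
  define anti where "anti M \<longleftrightarrow> M \<subseteq> D \<and> (\<forall>x\<in>M. \<forall>y\<in>M. x \<noteq> y \<longrightarrow> \<not> compatible P le x y)" for M
  have c_inj: "inj c"
    using c(3) le_imp_compatible[OF c(1) refl[OF c(1)]] by (intro injI) metis
  have anti_c: "anti (range c)"
    using D_down[OF d c(1,2)] c(3) unfolding anti_def by (metis image_subset_iff rangeE)
  have *: "\<exists>M\<in>{M. anti M \<and> range c \<subseteq> M}. \<forall>X\<in>{M. anti M \<and> range c \<subseteq> M}. M \<subseteq> X \<longrightarrow> X = M"
  proof (rule subset_Zorn_nonempty)
    show "{M. anti M \<and> range c \<subseteq> M} \<noteq> {}" using anti_c by blast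
    fix C assume C: "C \<noteq> {}" "subset.chain {M. anti M \<and> range c \<subseteq> M} C"
    have "\<not> compatible P le x y" if "x \<in> X" "X \<in> C" "y \<in> Y" "Y \<in> C" "x \<noteq> y" for x y X Y
    proof -
      have "X \<subseteq> Y \<or> Y \<subseteq> X" "anti X" "anti Y"
        using C(2) that by (auto simp: subset.chain_def)
      then show ?thesis using that by (auto simp: anti_def)
    qed
    moreover have "X \<subseteq> D" "range c \<subseteq> X" if "X \<in> C" for X
      using C(2) that unfolding subset.chain_def anti_def by blast+
    then have "\<Union>C \<subseteq> D" "range c \<subseteq> \<Union>C" using C(1) by blast+
    ultimately show "\<Union>C \<in> {M. anti M \<and> range c \<subseteq> M}"
      unfolding anti_def by blast
  qed
  obtain M where M: "anti M" "range c \<subseteq> M"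
    and maximal: "\<And>X. anti X \<Longrightarrow> M \<subseteq> X \<Longrightarrow> X = M"
  proof -
    from * obtain M where "M \<in> {M. anti M \<and> range c \<subseteq> M}"
      "\<forall>X\<in>{M. anti M \<and> range c \<subseteq> M}. M \<subseteq> X \<longrightarrow> X = M" by blast
    then show ?thesis by (intro that[of M]) auto
  qed
  have MP: "M \<subseteq> P" using M(1) by (auto simp: anti_def D_def)
  obtain en :: "'w \<Rightarrow> 'a" where "P = range en" using enumerated by blast
  then have "\<exists>k::'a \<Rightarrow> 'w. inj_on k M"
    using MP by (meson inj_on_inv_into)
  then obtain e :: "'w \<Rightarrow> 'a" where e: "bij_betw e UNIV M"
    using Schroeder_Bernstein[of c UNIV M] c_inj M(2) by blast
  have "\<exists>i. compatible P le x (e i)" if x: "x \<in> P" "\<forall>b\<in>B. le x b" for x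
  proof -
    obtain y where y: "y \<in> D" "le y x" using D_dense[OF x] by blast
    then have yP: "y \<in> P" by (simp add: D_def)
    have "\<exists>m\<in>M. compatible P le y m"
    proof (rule ccontr)
      assume no: "\<not> ?thesis"
      then have "anti (insert y M)"
        using M(1) y(1) compatible_sym[of P le _ y] by (auto simp: anti_def)
      then have "y \<in> M" using maximal by blast
      then show False using no le_imp_compatible[OF yP refl[OF yP]] by blast
    qed
    then obtain m where m: "m \<in> M" "compatible P le y m" by blast
    obtain i where "m = e i" using m(1) e by (auto simp: bij_betw_def)
    then show ?thesis
      using compatible_mono[OF m(2) yP _ x(1) _ y(2)] refl m(1) MP by blast
  qed
  moreover have "e i \<in> M" for i using e by (auto simp: bij_betw_def)
  moreover have "e i \<noteq> e j" if "i \<noteq> j" for i j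
    using e that by (auto simp: bij_betw_def inj_def)
  ultimately have "deciding_antichain B p e"
    using M(1) unfolding deciding_antichain_def anti_def D_def by blast
  then show ?thesis by blast
qed

text \<open>The recursion chooses at level \<open>a\<close> a deciding antichain for the branch so far and the
  \<open>a\<close>-th condition, and lets the label \<open>s a\<close> select a member.  For density, a condition \<open>p\<close> is
  followed through the tree: by recursion one picks labels together with a descending sequence of
  extensions of \<open>p\<close> lying below the nodes.  At the level whose index enumerates \<open>p\<close> the
  node is compatible with \<open>p\<close>, hence below it.\<close>

theorem full_width_tree_exists: "\<exists>F. full_width_tree P le (\<prec>) F"
proof -
  obtain en :: "'w \<Rightarrow> 'a" where en: "P = range en" using enumerated by blast
  define E where "E B p = (SOME e. deciding_antichain B p e)" for B p
  have E: "deciding_antichain B p (E B p)" if "countable B" "B \<subseteq> P" "\<And>p q. \<lbrakk>p \<in> B; q \<in> B\<rbrakk> \<Longrightarrow> le p q \<or> le q p"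
    "p \<in> P" for B p
    unfolding E_def
    using deciding_antichain_exists[OF countable_chain_bounded[OF that(1,2,3)] that(2,4)]
    by (rule someI_ex)
  define F where "F s = wfrec {(b, a). b \<prec> a} (\<lambda>f a. E (f ` {b. b \<prec> a}) (en a) (s a))" for s
  have wf: "wf {(b, a). b \<prec> a}" using wf_lt by (simp add: wfp_def)
  have F: "F s a = E (F s ` {b. b \<prec> a}) (en a) (s a)" for s a
  proof -
    have "F s a = E (cut (F s) {(b, a). b \<prec> a} a ` {b. b \<prec> a}) (en a) (s a)"
      unfolding F_def by (subst wfrec[OF wf]) simp
    also have "cut (F s) {(b, a). b \<prec> a} a ` {b. b \<prec> a} = F s ` {b. b \<prec> a}"
      by (rule image_cong) (auto simp: cut_apply)
    finally show ?thesis .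
  qed
  have node: "F s a \<in> P \<and> (\<forall>b. b \<prec> a \<longrightarrow> le (F s a) (F s b)) \<and>
      deciding_antichain (F s ` {b. b \<prec> a}) (en a) (E (F s ` {b. b \<prec> a}) (en a))"
    for s a
    using wf_lt
  proof (induction a rule: wfp_induct_rule)
    case (less a)
    have "deciding_antichain (F s ` {b. b \<prec> a}) (en a) (E (F s ` {b. b \<prec> a}) (en a))"
    proof (rule E)
      show "countable (F s ` {b. b \<prec> a})" using countable_below by blast
      show "F s ` {b. b \<prec> a} \<subseteq> P" "en a \<in> P" using less en by auto
      show "le p q \<or> le q p" if "p \<in> F s ` {b. b \<prec> a}" "q \<in> F s ` {b. b \<prec> a}" for p q
        using that less total_lt refl by fast
    qed
    then show ?case using F[of s a] by (auto simp: deciding_antichain_def)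
  qed
  have local: "F s a = F t a" if "\<And>b. b \<prec> a \<or> b = a \<Longrightarrow> s b = t b" for s t a
    using wf_lt that
  proof (induction a rule: wfp_induct_rule)
    case (less a)
    have "F s b = F t b" if "b \<prec> a" for b
      using less that trans_lt by metis
    then have "F s ` {b. b \<prec> a} = F t ` {b. b \<prec> a}" by (intro image_cong) auto
    then show ?case using less(2)[of a] F[of s a] F[of t a] by simp
  qed
  have branch: "\<exists>s. \<forall>a. \<exists>x\<in>P. le x p \<and> le x (F s a)" if p: "p \<in> P" for p
  proof -
    \<comment> \<open>Each value \<open>g a\<close> pairs an extension of \<open>p\<close> with the label chosen at level \<open>a\<close>.\<close>
    define step where "step g a r \<longleftrightarrow> fst r \<in> P \<and> le (fst r) p \<and> (\<forall>b. b \<prec> a \<longrightarrow> le (fst r) (fst (g b)))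
        \<and> le (fst r) (F ((snd \<circ> g)(a := snd r)) a)" for g :: "'w \<Rightarrow> 'a \<times> 'w" and a r
    have "\<exists>g. \<forall>a. step g a (g a)"
    proof (rule dependent_wf_choice[OF wf])
      fix f g :: "'w \<Rightarrow> 'a \<times> 'w" and a and r :: "'a \<times> 'w"
      assume eq: "\<And>z. (z, a) \<in> {(b, a). b \<prec> a} \<Longrightarrow> f z = g z"
      have "F ((snd \<circ> f)(a := snd r)) a = F ((snd \<circ> g)(a := snd r)) a"
        by (rule local) (use eq in auto)
      then show "step f a r = step g a r" using eq by (auto simp: step_def)
    next
      fix a and g :: "'w \<Rightarrow> 'a \<times> 'w"
      assume "\<And>b. (b, a) \<in> {(b, a). b \<prec> a} \<Longrightarrow> step g b (g b)"
      then have IH: "\<And>b. b \<prec> a \<Longrightarrow> step g b (g b)" by simp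
      define s where "s = snd \<circ> g"
      have below: "fst (g b) \<in> P" "le (fst (g b)) p" "le (fst (g b)) (F s b)" if "b \<prec> a" for b
        using IH[OF that] by (auto simp: step_def s_def fun_upd_idem)
      have dec: "le (fst (g b)) (fst (g c))" if "c \<prec> b" "b \<prec> a" for b c
        using IH[OF that(2)] that(1) by (auto simp: step_def)
      obtain y where y: "y \<in> P" "\<forall>b\<in>insert p ((fst \<circ> g) ` {b. b \<prec> a}). le y b"
      proof -
        have "\<exists>y\<in>P. \<forall>b\<in>insert p ((fst \<circ> g) ` {b. b \<prec> a}). le y b"
        proof (rule countable_chain_bounded)
          show "countable (insert p ((fst \<circ> g) ` {b. b \<prec> a}))"
            using countable_below by blast
          show "insert p ((fst \<circ> g) ` {b. b \<prec> a}) \<subseteq> P" using p below(1) by auto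
          have "le (fst (g b)) (fst (g c)) \<or> le (fst (g c)) (fst (g b))" if "b \<prec> a" "c \<prec> a" for b c
            using total_lt[of b c] dec that refl[OF below(1)] by blast
          then show "le q r \<or> le r q" if "q \<in> insert p ((fst \<circ> g) ` {b. b \<prec> a})"
              "r \<in> insert p ((fst \<circ> g) ` {b. b \<prec> a})" for q r
            using that below(2) refl[OF p] by auto
        qed
        then show ?thesis using that by blast
      qed
      have "le y (F s b)" if "b \<prec> a" for b
        using trans[OF y(1) below(1)[OF that] _ _ below(3)[OF that]] y(2) that node by auto
      then obtain i where i: "compatible P le y (E (F s ` {b. b \<prec> a}) (en a) i)"
        using node[of s a] y(1) by (fastforce simp: deciding_antichain_def)
      have "F (s(a := i)) b = F s b" if "b \<prec> a" for b
      proof (rule local)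
        have "\<not> a \<prec> a" using wf by (auto dest: wf_irrefl)
        then show "(s(a := i)) c = s c" if "c \<prec> b \<or> c = b" for c
          using that \<open>b \<prec> a\<close> trans_lt by (metis fun_upd_other)
      qed
      then have "F (s(a := i)) ` {b. b \<prec> a} = F s ` {b. b \<prec> a}" by (intro image_cong) auto
      then have "F (s(a := i)) a = E (F s ` {b. b \<prec> a}) (en a) i"
        using F[of "s(a := i)" a] by simp
      then obtain x where x: "x \<in> P" "le x y" "le x (F (s(a := i)) a)"
        using i by (auto simp: compatible_def)
      have "le x p" "\<And>b. b \<prec> a \<Longrightarrow> le x (fst (g b))"
        using trans[OF x(1) y(1) _ x(2)] y(2) p below(1) by auto
      then have "step g a (x, i)" using x by (auto simp: step_def s_def)
      then show "\<exists>r. step g a r" by blast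
    qed
    then obtain g where g: "\<And>a. step g a (g a)" by blast
    have "fst (g a) \<in> P \<and> le (fst (g a)) p \<and> le (fst (g a)) (F (snd \<circ> g) a)" for a
      using g[of a] by (auto simp: step_def fun_upd_idem)
    then show ?thesis by blast
  qed
  have "full_width_tree P le (\<prec>) F"
  proof unfold_locales
    show "F s a \<in> P" for s a using node by blast
    show "le (F s a) (F s b)" if "b \<prec> a" for s a b using node that by blast
    show "F s a = F t a" if "\<And>b. b \<prec> a \<or> b = a \<Longrightarrow> s b = t b" for s t a
      by (rule local) (rule that)
    show "\<not> compatible P le (F s a) (F t a)" if "\<And>b. b \<prec> a \<Longrightarrow> s b = t b" "s a \<noteq> t a" for s t a
    proof -
      have "F s b = F t b" if "b \<prec> a" for b
        by (rule local) (use \<open>\<And>b. b \<prec> a \<Longrightarrow> s b = t b\<close> that trans_lt in blast)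
      then have "F s ` {b. b \<prec> a} = F t ` {b. b \<prec> a}" by (intro image_cong) auto
      then show ?thesis using node[of s a] F[of s a] F[of t a] that(2) by (simp add: deciding_antichain_def)
    qed
    show "\<exists>s a. le (F s a) p" if p: "p \<in> P" for p
    proof -
      obtain a where a: "p = en a" using p en by blast
      obtain s x where x: "x \<in> P" "le x p" "le x (F s a)" using branch[OF p] by blast
      have "le (F s a) p \<or> \<not> compatible P le (F s a) p"
        using node[of s a] F[of s a] a by (simp add: deciding_antichain_def)
      then have "le (F s a) p" using x by (auto simp: compatible_def)
      then show ?thesis by blast
    qed
  qed
  then show ?thesis by blast
qed

end


section \<open>The Continuum Hypothesis\<close>

lemma countable_of_ordLess_cardSuc_natLeq:
  assumes "|X| <o cardSuc natLeq"
  shows "countable X"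
  using assms
  by (simp only: cardSuc_ordLeq_ordLess[OF natLeq_Card_order card_of_Card_order]
      countable_card_le_natLeq)

text \<open>A cardinal well-order of the continuum has initial segments smaller than \<open>\<aleph>\<^sub>1\<close>.\<close>

lemma Continuum_Hypothesis_imp_omega1_index:
  assumes "Continuum_Hypothesis"
  shows "\<exists>lt :: nat set \<Rightarrow> nat set \<Rightarrow> bool. omega1_index lt"
proof -
  define r where "r = |UNIV :: nat set set|"
  have co: "Card_order r" and field: "Field r = UNIV"
    unfolding r_def by (rule card_of_Card_order, rule Field_card_of)
  interpret r: wo_rel r
    using co by (simp add: wo_rel_def card_order_on_def)
  have "countable (underS r a)" for a
  proof -
    have "|underS r a| <o r" using card_of_underS[OF co] field by simp
    then have "|underS r a| <o cardSuc natLeq"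
      using assms ordLess_ordIso_trans by (auto simp: Continuum_Hypothesis_def r_def)
    then show ?thesis by (rule countable_of_ordLess_cardSuc_natLeq)
  qed
  then have countable: "countable {b. b \<noteq> a \<and> (b, a) \<in> r}" for a
    by (simp add: underS_def)
  have wf: "wf {(b, a). b \<noteq> a \<and> (b, a) \<in> r}"
    by (rule wf_subset[OF r.WF]) auto
  have "omega1_index (\<lambda>b a. b \<noteq> a \<and> (b, a) \<in> r)"
  proof
    show "wfp (\<lambda>b a. b \<noteq> a \<and> (b, a) \<in> r)" using wf by (simp add: wfp_def)
    show "a \<noteq> c \<and> (a, c) \<in> r" if "a \<noteq> b \<and> (a, b) \<in> r" "b \<noteq> c \<and> (b, c) \<in> r" for a b c
      using that r.TRANS r.ANTISYM by (auto dest: transD antisymD)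
    show "(a \<noteq> b \<and> (a, b) \<in> r) \<or> a = b \<or> (b \<noteq> a \<and> (b, a) \<in> r)" for a b
      using r.TOTALS field by auto
    show "countable {b. b \<noteq> a \<and> (b, a) \<in> r}" for a by (rule countable)
  qed
  then show ?thesis by blast
qed

section \<open>Ideals that are Fubini sums along a sequence of blocks\<close>

text \<open>The sets of initial segments of two distinct subsets of \<open>\<omega>\<close> meet in a finite set.  Recording the
  length \<open>n\<close> along with the segment keeps the branch of a finite set infinite.\<close>

lemma almost_disjoint_family_exists:
  assumes "infinite N"
  shows "\<exists>D :: nat set \<Rightarrow> nat set. (\<forall>x. D x \<subseteq> N \<and> infinite (D x)) \<and>
     (\<forall>x y. x \<noteq> y \<longrightarrow> finite (D x \<inter> D y))"
proof -
  define c where "c x n = enumerate N (prod_encode (n, set_encode (x \<inter> {..<n})))" for x n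
  have c_eq: "n = m \<and> x \<inter> {..<n} = y \<inter> {..<m}" if "c x n = c y m" for x y n m
  proof -
    have "prod_encode (n, set_encode (x \<inter> {..<n})) = prod_encode (m, set_encode (y \<inter> {..<m}))"
      using that injD[OF inj_enumerate[OF assms]] unfolding c_def by blast
    then show ?thesis by (auto simp: set_encode_eq)
  qed
  have "inj (c x)" for x using c_eq by (auto intro: injI)
  then have "infinite (range (c x))" for x by (rule range_inj_infinite)
  moreover have "range (c x) \<subseteq> N" for x
    using enumerate_in_set[OF assms] by (auto simp: c_def)
  moreover have "finite (range (c x) \<inter> range (c y))" if "x \<noteq> y" for x y
  proof -
    obtain k where k: "(k \<in> x) \<noteq> (k \<in> y)" using \<open>x \<noteq> y\<close> by blast
    have bound: "n \<le> k" if "c x n = c y m" for n m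
    proof (rule ccontr)
      assume "\<not> n \<le> k"
      moreover have "m = n" "x \<inter> {..<n} = y \<inter> {..<m}" using c_eq[OF that] by blast+
      ultimately have "k \<in> x \<inter> {..<n} \<longleftrightarrow> k \<in> y \<inter> {..<n}" "k < n" by auto
      then show False using k by simp
    qed
    have "range (c x) \<inter> range (c y) \<subseteq> c x ` {..k}"
    proof
      fix z assume "z \<in> range (c x) \<inter> range (c y)"
      then obtain n m where nm: "z = c x n" "z = c y m" by (elim IntE imageE)
      then have "n \<le> k" using bound[of n m] by simp
      then show "z \<in> c x ` {..k}" using nm(1) by simp
    qed
    then show ?thesis by (rule finite_subset) simp
  qed
  ultimately show ?thesis by (intro exI[of _ "\<lambda>x. range (c x)"]) auto
qed

text \<open>An abstract form of ideals on \<open>\<omega>\<close> such as \<open>Fin\<close> and \<open>\<H>\<close>: the support of \<open>X\<close> collects the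
  indices of the blocks on which \<open>X\<close> is positive, and \<open>X\<close> is in the ideal iff its support is
  finite.\<close>

locale block_support =
  fixes B :: "nat \<Rightarrow> nat set" and supp :: "nat set \<Rightarrow> nat set"
  assumes supp_Un: "supp (X \<union> Y) = supp X \<union> supp Y"
    and supp_blocks: "supp (X \<inter> (\<Union>n\<in>a. B n)) = supp X \<inter> a"
    and infinite_supp_UNIV: "infinite (supp UNIV)"
begin

definition positive :: "nat set set" where
  "positive = {X. infinite (supp X)}"

definition le_supp :: "nat set \<Rightarrow> nat set \<Rightarrow> bool" where
  "le_supp X Y \<longleftrightarrow> finite (supp (X - Y))"

lemma supp_mono: "X \<subseteq> Y \<Longrightarrow> supp X \<subseteq> supp Y"
  using supp_Un[of X Y] by (metis Un_absorb1 sup_ge1)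

lemma finite_supp_subset: "\<lbrakk>finite (supp Y); X \<subseteq> Y\<rbrakk> \<Longrightarrow> finite (supp X)"
  by (rule finite_subset[OF supp_mono])

lemma le_supp_trans:
  assumes "le_supp X Y" "le_supp Y Z"
  shows "le_supp X Z"
proof -
  have "finite (supp ((X - Y) \<union> (Y - Z)))" using assms by (simp add: le_supp_def supp_Un)
  then show ?thesis unfolding le_supp_def by (rule finite_supp_subset) blast
qed

lemma le_supp_refl: "le_supp X X"
  using supp_blocks[of X "{}"] by (simp add: le_supp_def)

lemma finite_supp_Union:
  assumes "finite I" "\<And>i. i \<in> I \<Longrightarrow> finite (supp (X i))"
  shows "finite (supp (\<Union>i\<in>I. X i))"
  using assms
proof (induction rule: finite_induct)
  case empty
  then show ?case using le_supp_refl by (simp add: le_supp_def)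
qed (simp add: supp_Un)

text \<open>From the \<open>n\<close>-th intersection \<open>Z n\<close> take a single block \<open>k n\<close> in its support, with \<open>k\<close> strictly
  increasing.  The union of these pieces leaves \<open>X n\<close> only within the finitely many blocks chosen
  before stage \<open>n\<close>.\<close>

lemma pseudo_intersection:
  assumes X: "\<And>n. X n \<in> positive" and dec: "\<And>n::nat. le_supp (X (Suc n)) (X n)"
  shows "\<exists>Y\<in>positive. \<forall>n. le_supp Y (X n)"
proof -
  define Z where "Z n = (\<Inter>i\<le>n. X i)" for n
  have "le_supp (X n) (X i)" if "i \<le> n" for i n
    using that by (induction rule: dec_induct) (use le_supp_refl dec le_supp_trans in blast)+
  then have "finite (supp (\<Union>i\<le>n. X n - X i))" for n
    by (intro finite_supp_Union) (auto simp: le_supp_def)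
  moreover have "supp (X n) \<subseteq> supp (Z n) \<union> supp (\<Union>i\<le>n. X n - X i)" for n
    unfolding supp_Un[symmetric] by (rule supp_mono) (auto simp: Z_def)
  ultimately have Z: "infinite (supp (Z n))" for n
    using X unfolding positive_def by (metis (mono_tags) finite_UnI finite_subset mem_Collect_eq)
  have "\<exists>k. \<forall>n. k n \<in> supp (Z n) \<and> k n < k (Suc n)"
    by (rule dependent_nat_choice)
      (use Z infinite_imp_nonempty infinite_nat_iff_unbounded in blast)+
  then obtain k where k: "\<And>n. k n \<in> supp (Z n)" "strict_mono k"
    by (auto simp: strict_mono_Suc_iff)
  define Y where "Y = (\<Union>n. Z n \<inter> B (k n))"
  have "k n \<in> supp Y" for n
    using supp_blocks[of "Z n" "{k n}"] k(1)[of n] supp_mono[of "Z n \<inter> B (k n)" Y]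
    by (auto simp: Y_def)
  then have "range k \<subseteq> supp Y" by blast
  then have "Y \<in> positive"
    using range_inj_infinite[OF strict_mono_imp_inj_on[OF k(2)]] finite_subset
    by (auto simp: positive_def)
  moreover have "le_supp Y (X n)" for n
  proof -
    have "Y - X n \<subseteq> UNIV \<inter> (\<Union>m\<in>k ` {..<n}. B m)"
      by (force simp: Y_def Z_def not_less)
    then have "supp (Y - X n) \<subseteq> k ` {..<n}"
      using supp_mono supp_blocks[of UNIV "k ` {..<n}"] by blast
    then show ?thesis unfolding le_supp_def by (rule finite_subset) simp
  qed
  ultimately show ?thesis by blast
qed

lemma forcing_notion_positive: "forcing_notion positive le_supp"
  by unfold_locales (use le_supp_refl le_supp_trans in blast)+

text \<open>Restricting \<open>X\<close> to the blocks in \<open>a \<subseteq> supp X\<close> gives a set with support \<open>a\<close>; almost disjoint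
  supports make the intersection of two such sets null.\<close>

lemma large_antichain:
  assumes "X \<in> positive"
  shows "\<exists>c :: nat set \<Rightarrow> nat set. (\<forall>i. c i \<in> positive \<and> le_supp (c i) X) \<and>
     (\<forall>i j. i \<noteq> j \<longrightarrow> \<not> compatible positive le_supp (c i) (c j))"
proof -
  obtain D :: "nat set \<Rightarrow> nat set" where D: "\<And>x. D x \<subseteq> supp X" "\<And>x. infinite (D x)"
      "\<And>x y. x \<noteq> y \<Longrightarrow> finite (D x \<inter> D y)"
    using almost_disjoint_family_exists[of "supp X"] assms unfolding positive_def by blast
  define c where "c x = X \<inter> (\<Union>n\<in>D x. B n)" for x
  have supp_c: "supp (c x) = D x" for x
    using D(1)[of x] by (auto simp: c_def supp_blocks)
  have "\<not> compatible positive le_supp (c x) (c y)" if "x \<noteq> y" for x y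
  proof
    assume "compatible positive le_supp (c x) (c y)"
    then obtain Z where Z: "infinite (supp Z)" "finite (supp (Z - c x))" "finite (supp (Z - c y))"
      by (auto simp: compatible_def positive_def le_supp_def)
    have "supp (c x \<inter> c y) \<subseteq> D x \<inter> D y"
      using supp_mono[of "c x \<inter> c y" "c x"] supp_mono[of "c x \<inter> c y" "c y"] supp_c by blast
    then have "finite (supp (c x \<inter> c y))" using D(3)[OF that] finite_subset by blast
    then have "finite (supp ((Z - c x) \<union> (Z - c y) \<union> (c x \<inter> c y)))"
      using Z by (simp add: supp_Un)
    then have "finite (supp Z)" by (rule finite_supp_subset) blast
    then show False using Z(1) by blast
  qed
  moreover have "c x \<in> positive" "le_supp (c x) X" for x
    using D(2) supp_c le_supp_refl[of X] finite_supp_subset[of "X - X" "c x - X"]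
    by (auto simp: positive_def le_supp_def c_def)
  ultimately show ?thesis by blast
qed

theorem sigma_closed_positive:
  assumes "omega1_index (lt :: nat set \<Rightarrow> nat set \<Rightarrow> bool)"
  shows "sigma_closed_forcing positive le_supp lt"
proof -
  interpret forcing_notion positive le_supp by (rule forcing_notion_positive)
  interpret omega1_index lt by fact
  show ?thesis
  proof
    show ne: "positive \<noteq> {}" using infinite_supp_UNIV by (auto simp: positive_def)
    show "\<exists>y\<in>positive. \<forall>n. le_supp y (x n)"
      if "\<And>n. x n \<in> positive" "\<And>n::nat. le_supp (x (Suc n)) (x n)" for x
      using pseudo_intersection that by blast
    show "\<exists>c :: nat set \<Rightarrow> nat set. (\<forall>i. c i \<in> positive \<and> le_supp (c i) p) \<and>
       (\<forall>i j. i \<noteq> j \<longrightarrow> \<not> compatible positive le_supp (c i) (c j))" if "p \<in> positive" for p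
      using large_antichain[OF that] .
    obtain X where "X \<in> positive" using ne by blast
    \<comment> \<open>The fixed \<open>X\<close> is a default value for the sets outside \<open>positive\<close>.\<close>
    then have "positive = range (\<lambda>Y. if Y \<in> positive then Y else X)" by auto
    then show "\<exists>e :: nat set \<Rightarrow> nat set. positive = range e" by blast
  qed
qed

end

section \<open>Infinite sets modulo finite sets\<close>

interpretation Fin: block_support "\<lambda>n. {n}" "\<lambda>X. X"
  by unfold_locales auto

lemma abs_pow_fin_le_iff: "abs_pow_fin X \<le> abs_pow_fin Y \<longleftrightarrow> Fin.le_supp X Y"
  by (simp add: less_eq_pow_fin.abs_eq Fin.le_supp_def)

lemma abs_pow_fin_eq_bot_iff: "abs_pow_fin X = bot \<longleftrightarrow> finite X"
  by (simp add: bot_pow_fin_def pow_fin.abs_eq_iff eq_fin_def)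

lemma abs_pow_fin_image_positive: "abs_pow_fin ` Fin.positive = {a. a \<noteq> bot}"
proof (intro equalityI subsetI)
  fix a :: pow_fin assume "a \<in> {a. a \<noteq> bot}"
  then show "a \<in> abs_pow_fin ` Fin.positive"
    by (induction a rule: pow_fin.abs_induct) (simp add: abs_pow_fin_eq_bot_iff Fin.positive_def)
qed (auto simp: abs_pow_fin_eq_bot_iff Fin.positive_def)


section \<open>Positive sets at the nodes of a tree partition\<close>

text \<open>Positivity relative to a cell \<open>A s\<close>: some infinitely branching subtree of \<open>T_inf A X\<close> passes
  through \<open>s\<close>.  Such a subtree is a set of nodes \<open>S\<close> contained in its own derivative.\<close>

definition positive_at :: "(nat list \<Rightarrow> nat set) \<Rightarrow> nat set \<Rightarrow> nat list \<Rightarrow> bool" where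
  "positive_at A X s \<longleftrightarrow> (\<exists>S. s \<in> S \<and> S \<subseteq> T_inf A X \<and> S \<subseteq> Der S)"

lemma positive_at_coinduct:
  assumes "s \<in> S" "\<And>t. t \<in> S \<Longrightarrow> infinite (X \<inter> A t)"
    "\<And>t. t \<in> S \<Longrightarrow> infinite {n. t @ [n] \<in> S}"
  shows "positive_at A X s"
  unfolding positive_at_def
  using assms by (intro exI[of _ S]) (auto simp: T_inf_def Der_def Succ_nodes_def)

lemma positive_atD:
  assumes "positive_at A X s"
  shows "infinite (X \<inter> A s)" "infinite {n. positive_at A X (s @ [n])}"
proof -
  obtain S where S: "s \<in> S" "S \<subseteq> T_inf A X" "S \<subseteq> Der S"
    using assms by (auto simp: positive_at_def)
  then have "positive_at A X t" if "t \<in> S" for t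
    using that by (auto simp: positive_at_def)
  then have "Succ_nodes S s \<subseteq> {n. positive_at A X (s @ [n])}"
    by (auto simp: Succ_nodes_def)
  moreover have "infinite (Succ_nodes S s)" "infinite (X \<inter> A s)"
    using S by (auto simp: Der_def T_inf_def)
  ultimately show "infinite (X \<inter> A s)" "infinite {n. positive_at A X (s @ [n])}"
    using finite_subset by blast+
qed

lemma Der_mono: "S \<subseteq> T \<Longrightarrow> Der S \<subseteq> Der T"
proof
  fix s assume "S \<subseteq> T" "s \<in> Der S"
  then have "infinite (Succ_nodes S s)" "s \<in> T" "Succ_nodes S s \<subseteq> Succ_nodes T s"
    by (auto simp: Der_def Succ_nodes_def)
  then show "s \<in> Der T" using infinite_super by (auto simp: Der_def)
qed

lemma omega1_uncountable: "uncountable (Field omega1)"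
proof
  assume "countable (Field omega1)"
  then have "|Field omega1| \<le>o natLeq" by (simp add: countable_card_le_natLeq)
  then have "omega1 \<le>o natLeq"
    using card_of_Field_ordIso[OF card_order_omega1] ordIso_ordLeq_trans ordIso_symmetric by blast
  moreover have "natLeq <o omega1"
    unfolding omega1_def by (rule cardSuc_greater[OF natLeq_Card_order])
  ultimately show False using not_ordLess_ordLeq by blast
qed

text \<open>The regularity of \<open>\<omega>\<^sub>1\<close>, for countable families.\<close>

lemma omega1_bounded:
  assumes "\<And>n::nat. f n \<in> Field omega1"
  shows "\<exists>\<alpha>\<in>Field omega1. \<forall>n. (f n, \<alpha>) \<in> omega1"
proof (rule ccontr)
  assume neg: "\<not> ?thesis"
  have "countable (underS omega1 \<beta>)" if "\<beta> \<in> Field omega1" for \<beta>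
  proof -
    have "|underS omega1 \<beta>| <o omega1" using card_of_underS[OF card_order_omega1 that] .
    then show ?thesis
      using countable_of_ordLess_cardSuc_natLeq by (simp add: omega1_def)
  qed
  then have "countable (\<Union>n. underS omega1 (f n))" using assms by blast
  moreover have "Field omega1 \<subseteq> (\<Union>n. underS omega1 (f n))"
  proof
    fix \<beta> assume \<beta>: "\<beta> \<in> Field omega1"
    then obtain n where n: "(f n, \<beta>) \<notin> omega1" using neg by blast
    then have "(\<beta>, f n) \<in> omega1" "\<beta> \<noteq> f n"
      using wo_rel.TOTALS[OF wo_rel_omega1] \<beta> assms by blast+
    then show "\<beta> \<in> (\<Union>n. underS omega1 (f n))" by (auto simp: underS_def)
  qed
  ultimately show False using omega1_uncountable countable_subset by blast
qed

lemma Der_iter_antimono: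
  assumes "(\<beta>, \<alpha>) \<in> omega1"
  shows "Der_iter T \<alpha> \<subseteq> Der_iter T \<beta>"
proof -
  interpret w: wo_rel omega1 by (rule wo_rel_omega1)
  have "\<forall>\<beta>. (\<beta>, \<alpha>) \<in> omega1 \<longrightarrow> Der_iter T \<alpha> \<subseteq> Der_iter T \<beta>" for \<alpha>
  proof (induction \<alpha> rule: w.well_order_induct)
    case (1 \<alpha>)
    show ?case
    proof (intro allI impI)
      fix \<beta> assume \<beta>: "(\<beta>, \<alpha>) \<in> omega1"
      show "Der_iter T \<alpha> \<subseteq> Der_iter T \<beta>"
      proof (cases "\<beta> = \<alpha>")
        case False
        then have below: "\<beta> \<in> underS omega1 \<alpha>" using \<beta> by (simp add: underS_def)
        show ?thesis
        proof (cases "\<exists>\<gamma>\<in>underS omega1 \<alpha>. \<alpha> = omega1_succ \<gamma>")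
          case True
          then obtain \<gamma> where \<gamma>: "\<gamma> \<in> underS omega1 \<alpha>" "\<alpha> = omega1_succ \<gamma>" by blast
          have fields: "\<gamma> \<in> Field omega1" "\<beta> \<in> Field omega1"
            using \<gamma>(1) \<beta> by (auto simp: underS_def Field_def)
          have "(\<beta>, \<gamma>) \<in> omega1"
          proof (rule ccontr)
            assume "(\<beta>, \<gamma>) \<notin> omega1"
            then have "\<gamma> \<in> underS omega1 \<beta>"
              using w.TOTALS w.REFL fields by (auto simp: underS_def refl_on_def)
            then have "(\<alpha>, \<beta>) \<in> omega1" using omega1_succ_least \<gamma>(2) by blast
            then show False using False \<beta> w.ANTISYM by (auto dest: antisymD)
          qed
          then have "Der_iter T \<gamma> \<subseteq> Der_iter T \<beta>"
            using 1 \<gamma>(1) by (auto simp: underS_def)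
          moreover have "Der_iter T \<alpha> \<subseteq> Der_iter T \<gamma>"
            using Der_iter_succ[OF fields(1)] \<gamma>(2) by (auto simp: Der_def)
          ultimately show ?thesis by blast
        next
          case False
          then have "Der_iter T \<alpha> = (\<Inter>\<beta>\<in>underS omega1 \<alpha>. Der_iter T \<beta>)"
            using below by (intro Der_iter_limit) auto
          then show ?thesis using below by blast
        qed
      qed simp
    qed
  qed
  then show ?thesis using assms by blast
qed

lemma Der_iter_ge_post_fixpoint:
  assumes "S \<subseteq> T" "S \<subseteq> Der S"
  shows "S \<subseteq> Der_iter T \<alpha>"
proof -
  interpret w: wo_rel omega1 by (rule wo_rel_omega1)
  show ?thesis
  proof (induction \<alpha> rule: w.well_order_induct)
    case (1 \<alpha>)
    then have IH: "S \<subseteq> Der_iter T \<beta>" if "\<beta> \<in> underS omega1 \<alpha>" for \<beta>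
      using that by (auto simp: underS_def)
    show ?case
    proof (cases "\<exists>\<beta>\<in>underS omega1 \<alpha>. \<alpha> = omega1_succ \<beta>")
      case True
      then obtain \<beta> where \<beta>: "\<beta> \<in> underS omega1 \<alpha>" "\<alpha> = omega1_succ \<beta>" by blast
      then have "\<beta> \<in> Field omega1" by (auto simp: underS_def Field_def)
      then show ?thesis
        using Der_iter_succ[of \<beta> T] \<beta>(2) assms(2) Der_mono[OF IH[OF \<beta>(1)]] by simp
    next
      case False
      then show ?thesis
        using IH assms(1) by (subst Der_iter_unfold) auto
    qed
  qed
qed

lemma Der_iter_subset: "Der_iter T \<alpha> \<subseteq> T"
proof -
  interpret w: wo_rel omega1 by (rule wo_rel_omega1)
  show ?thesis
  proof (induction \<alpha> rule: w.well_order_induct)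
    case (1 \<alpha>)
    then have IH: "Der_iter T \<beta> \<subseteq> T" if "\<beta> \<in> underS omega1 \<alpha>" for \<beta>
      using that by (auto simp: underS_def)
    show ?case
    proof (cases "\<exists>\<beta>\<in>underS omega1 \<alpha>. \<alpha> = omega1_succ \<beta>")
      case True
      then obtain \<beta> where \<beta>: "\<beta> \<in> underS omega1 \<alpha>" "\<alpha> = omega1_succ \<beta>" by blast
      then have "\<beta> \<in> Field omega1" by (auto simp: underS_def Field_def)
      then show ?thesis
        using Der_iter_succ[of \<beta> T] \<beta>(2) IH[OF \<beta>(1)] by (auto simp: Der_def)
    next
      case False
      then show ?thesis using IH by (subst Der_iter_unfold) auto
    qed
  qed
qed

text \<open>If \<open>s\<close> had only finitely many successors in \<open>K\<close>, all its other successors would be gone by some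
  common stage \<open>\<alpha> < \<omega>\<^sub>1\<close>, and \<open>s\<close> itself at stage \<open>\<alpha> + 1\<close>.\<close>

lemma Inter_Der_iter_post_fixpoint:
  fixes T :: "nat list set"
  defines "K \<equiv> (\<Inter>\<alpha>\<in>Field omega1. Der_iter T \<alpha>)"
  shows "K \<subseteq> Der K"
proof
  fix s assume s: "s \<in> K"
  have "infinite (Succ_nodes K s)"
  proof
    assume fin: "finite (Succ_nodes K s)"
    have "\<exists>\<alpha>\<in>Field omega1. s @ [n] \<in> K \<or> s @ [n] \<notin> Der_iter T \<alpha>" for n
      using omega1_uncountable by (cases "Field omega1 = {}") (auto simp: K_def)
    then obtain f where f: "\<And>n. f n \<in> Field omega1" "\<And>n. s @ [n] \<in> K \<or> s @ [n] \<notin> Der_iter T (f n)"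
      by metis
    obtain \<alpha> where \<alpha>: "\<alpha> \<in> Field omega1" "\<And>n. (f n, \<alpha>) \<in> omega1"
      using omega1_bounded[of f, OF f(1)] by blast
    have "Succ_nodes (Der_iter T \<alpha>) s \<subseteq> Succ_nodes K s"
      using f(2) Der_iter_antimono[OF \<alpha>(2)] by (auto simp: Succ_nodes_def)
    then have "s \<notin> Der_iter T (omega1_succ \<alpha>)"
      using fin finite_subset by (auto simp: Der_iter_succ[OF \<alpha>(1)] Der_def)
    moreover have "omega1_succ \<alpha> \<in> Field omega1"
      using omega1_succ_greater[OF \<alpha>(1)] by (auto simp: underS_def Field_def)
    ultimately show False using s by (auto simp: K_def)
  qed
  then show "s \<in> Der K" using s by (simp add: Der_def)
qed

text \<open>A subset contained in its own derivative survives every stage, and the nodes that survive every stage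
  form such a subset.\<close>

lemma H_plus_iff: "X \<in> H_plus A \<longleftrightarrow> positive_at A X []"
proof
  assume "X \<in> H_plus A"
  then have "[] \<in> (\<Inter>\<alpha>\<in>Field omega1. Der_iter (T_inf A X) \<alpha>)"
    by (auto simp: H_plus_def H_ideal_def)
  moreover have "(\<Inter>\<alpha>\<in>Field omega1. Der_iter (T_inf A X) \<alpha>) \<subseteq> T_inf A X"
  proof -
    obtain \<alpha> where "\<alpha> \<in> Field omega1" using omega1_uncountable by fastforce
    then show ?thesis using Der_iter_subset[of _ \<alpha>] by blast
  qed
  ultimately show "positive_at A X []"
    unfolding positive_at_def using Inter_Der_iter_post_fixpoint by metis
next
  assume "positive_at A X []"
  then show "X \<in> H_plus A"
    using Der_iter_ge_post_fixpoint unfolding positive_at_def H_plus_def H_ideal_def by blast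
qed

lemma positive_at_cong:
  assumes "\<And>u. X \<inter> A (s @ u) = Y \<inter> A (s @ u)" "positive_at A X s"
  shows "positive_at A Y s"
proof (rule positive_at_coinduct[where S = "{s @ u | u. positive_at A X (s @ u)}"])
  show "s \<in> {s @ u | u. positive_at A X (s @ u)}" using assms(2) by (auto intro: exI[of _ "[]"])
  fix t assume "t \<in> {s @ u | u. positive_at A X (s @ u)}"
  then obtain u where u: "t = s @ u" "positive_at A X (s @ u)" by blast
  then show "infinite (Y \<inter> A t)" using positive_atD(1)[of A X t] assms(1) by simp
  have "{n. positive_at A X (t @ [n])} \<subseteq> {n. t @ [n] \<in> {s @ u | u. positive_at A X (s @ u)}}"
    using u by auto
  then show "infinite {n. t @ [n] \<in> {s @ u | u. positive_at A X (s @ u)}}"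
    using positive_atD(2)[of A X t] u finite_subset by blast
qed

lemma positive_at_mono: "\<lbrakk>X \<subseteq> Y; positive_at A X s\<rbrakk> \<Longrightarrow> positive_at A Y s"
proof (rule positive_at_coinduct[where S = "Collect (positive_at A X)"])
  fix t assume "X \<subseteq> Y" "t \<in> Collect (positive_at A X)"
  then show "infinite (Y \<inter> A t)" "infinite {n. t @ [n] \<in> Collect (positive_at A X)}"
    using positive_atD[of A X t] infinite_super[of "X \<inter> A t" "Y \<inter> A t"] by auto
qed simp

context
  fixes A :: "nat list \<Rightarrow> nat set"
  assumes tree: "tree_partition A"
begin

lemma cell_append_subset: "A (s @ u) \<subseteq> A s"
proof (induction u rule: rev_induct)
  case (snoc n u)
  have "A ((s @ u) @ [n]) \<subseteq> A (s @ u)"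
    using tree unfolding tree_partition_def by blast
  then show ?case using snoc by auto
qed simp

lemma cells_disjoint: "\<lbrakk>x \<in> A (s @ [n]); x \<in> A (s @ [m])\<rbrakk> \<Longrightarrow> n = m"
  using tree unfolding tree_partition_def disjoint_family_on_def by blast

text \<open>Infinitely many positive successors meet \<open>X\<close> in nonempty, pairwise disjoint subsets of \<open>A s\<close>, so
  the trace of \<open>X\<close> on \<open>A s\<close> is infinite automatically.\<close>

lemma positive_at_iff: "positive_at A X s \<longleftrightarrow> infinite {n. positive_at A X (s @ [n])}"
proof
  assume inf: "infinite {n. positive_at A X (s @ [n])}" (is "infinite ?N")
  have "infinite (X \<inter> A s)"
  proof
    assume "finite (X \<inter> A s)"
    moreover have "finite {n. x \<in> A (s @ [n])}" for x
    proof (cases "\<exists>n. x \<in> A (s @ [n])")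
      case True
      then obtain n where "x \<in> A (s @ [n])" by blast
      then have "{n. x \<in> A (s @ [n])} \<subseteq> {n}" using cells_disjoint by blast
      then show ?thesis by (rule finite_subset) simp
    qed simp
    ultimately have "finite (\<Union>x\<in>X \<inter> A s. {n. x \<in> A (s @ [n])})" by blast
    moreover have "?N \<subseteq> (\<Union>x\<in>X \<inter> A s. {n. x \<in> A (s @ [n])})"
    proof
      fix n assume "n \<in> ?N"
      then obtain x where "x \<in> X \<inter> A (s @ [n])"
        using positive_atD(1)[of A X "s @ [n]"] infinite_imp_nonempty by blast
      then show "n \<in> (\<Union>x\<in>X \<inter> A s. {n. x \<in> A (s @ [n])})"
        using cell_append_subset[of s "[n]"] by blast
    qed
    ultimately show False using inf finite_subset by blast
  qed
  moreover have "infinite {n. t @ [n] \<in> insert s {t. positive_at A X t}}"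
    if "infinite {n. positive_at A X (t @ [n])}" for t
    using that by (rule infinite_super[rotated]) blast
  ultimately show "positive_at A X s"
    using inf positive_atD
    by (intro positive_at_coinduct[where S = "insert s {t. positive_at A X t}"]) auto
qed (rule positive_atD)

text \<open>Let \<open>S\<close> consist of the nodes where \<open>X \<union> Y\<close> is positive and \<open>X\<close> is not.  A node in \<open>S\<close> has only
  finitely many successors where \<open>X\<close> is positive, hence infinitely many in \<open>S\<close>.  Moreover \<open>Y\<close> is infinite in
  its cell, for otherwise the traces of \<open>X\<close> and \<open>X \<union> Y\<close> below it would differ by finite sets and \<open>X\<close>
  would be positive there.  So \<open>S\<close> witnesses that \<open>Y\<close> is positive.\<close>

lemma positive_at_Un:
  assumes "positive_at A (X \<union> Y) s"
  shows "positive_at A X s \<or> positive_at A Y s"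
proof (rule ccontr)
  assume neg: "\<not> ?thesis"
  define S where "S = {t. positive_at A (X \<union> Y) t \<and> \<not> positive_at A X t}"
  have "positive_at A Y s"
  proof (rule positive_at_coinduct)
    show "s \<in> S" using assms neg by (simp add: S_def)
    fix t assume t: "t \<in> S"
    show Y: "infinite (Y \<inter> A t)"
    proof
      assume fin: "finite (Y \<inter> A t)"
      have "positive_at A X t"
      proof (rule positive_at_coinduct[where S = "{t @ u | u. positive_at A (X \<union> Y) (t @ u)}"])
        show "t \<in> {t @ u | u. positive_at A (X \<union> Y) (t @ u)}"
          using t by (auto simp: S_def intro: exI[of _ "[]"])
        fix t' assume "t' \<in> {t @ u | u. positive_at A (X \<union> Y) (t @ u)}"
        then obtain u where u: "t' = t @ u" "positive_at A (X \<union> Y) (t @ u)" by blast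
        then have inf: "infinite ((X \<union> Y) \<inter> A t')" "infinite {n. positive_at A (X \<union> Y) (t' @ [n])}"
          using positive_atD by blast+
        have "finite (Y \<inter> A t')"
          using finite_subset[OF _ fin] cell_append_subset[of t u] u(1) by blast
        then show "infinite (X \<inter> A t')" using inf(1) by (simp add: Int_Un_distrib2)
        have "{n. positive_at A (X \<union> Y) (t' @ [n])} \<subseteq> {n. t' @ [n] \<in> {t @ u | u. positive_at A (X \<union> Y) (t @ u)}}"
          using u(1) by auto
        then show "infinite {n. t' @ [n] \<in> {t @ u | u. positive_at A (X \<union> Y) (t @ u)}}"
          using inf(2) finite_subset by blast
      qed
      then show False using t by (simp add: S_def)
    qed
    have "finite {n. positive_at A X (t @ [n])}"
      using t positive_at_iff[of X t] by (simp add: S_def)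
    moreover have "infinite {n. positive_at A (X \<union> Y) (t @ [n])}"
      using t positive_at_iff[of "X \<union> Y" t] by (simp add: S_def)
    ultimately have "infinite ({n. positive_at A (X \<union> Y) (t @ [n])} - {n. positive_at A X (t @ [n])})"
      by simp
    then show "infinite {n. t @ [n] \<in> S}" by (simp add: S_def set_diff_eq)
  qed
  then show False using neg by blast
qed

text \<open>The blocks of \<open>\<H>\<close> are the cells of the first level.\<close>

lemma block_support_tree: "block_support (\<lambda>n. A [n]) (\<lambda>X. {n. positive_at A X [n]})"
proof
  show "{n. positive_at A (X \<union> Y) [n]} = {n. positive_at A X [n]} \<union> {n. positive_at A Y [n]}" for X Y
    using positive_at_Un positive_at_mono[of X "X \<union> Y" A] positive_at_mono[of Y "X \<union> Y" A] by blast
  show "{n. positive_at A (X \<inter> (\<Union>n\<in>a. A [n])) [n]} = {n. positive_at A X [n]} \<inter> a" for X a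
  proof (intro equalityI subsetI)
    fix n assume "n \<in> {n. positive_at A (X \<inter> (\<Union>n\<in>a. A [n])) [n]}"
    then have n: "positive_at A (X \<inter> (\<Union>n\<in>a. A [n])) [n]" by simp
    then obtain x where "x \<in> X \<inter> (\<Union>n\<in>a. A [n]) \<inter> A [n]"
      using infinite_imp_nonempty[OF positive_atD(1)[OF n]] by blast
    then have "n \<in> a" using cells_disjoint[of x "[]"] by auto
    then show "n \<in> {n. positive_at A X [n]} \<inter> a" using n positive_at_mono by blast
  next
    fix n assume n: "n \<in> {n. positive_at A X [n]} \<inter> a"
    then have "A ([n] @ u) \<subseteq> (\<Union>n\<in>a. A [n])" for u
      using cell_append_subset[of "[n]" u] by blast
    then have "X \<inter> A ([n] @ u) = X \<inter> (\<Union>n\<in>a. A [n]) \<inter> A ([n] @ u)" for u by blast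
    then show "n \<in> {n. positive_at A (X \<inter> (\<Union>n\<in>a. A [n])) [n]}"
      using positive_at_cong[of X A "[n]"] n by blast
  qed
  have "positive_at A UNIV s" for s
    by (rule positive_at_coinduct[where S = UNIV])
      (use tree in \<open>auto simp: tree_partition_def\<close>)
  then show "infinite {n. positive_at A UNIV [n]}" by simp
qed

end


section \<open>The forcing equivalence\<close>

theorem corollary8p8:
  fixes A :: "nat list \<Rightarrow> nat set"
  assumes "tree_partition A"
    and "Continuum_Hypothesis"
  shows "forcing_equivalent (H_plus A) (le_H A) {a :: pow_fin. a \<noteq> bot} (\<le>)"
proof -
  interpret H: block_support "\<lambda>n. A [n]" "\<lambda>X. {n. positive_at A X [n]}"
    by (rule block_support_tree[OF assms(1)])
  have positive: "X \<in> H_plus A \<longleftrightarrow> infinite {n. positive_at A X [n]}" for X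
    using H_plus_iff positive_at_iff[OF assms(1), of X "[]"] by simp
  have H: "H.positive = H_plus A" "H.le_supp = le_H A"
    using positive by (auto simp: H.positive_def H.le_supp_def le_H_def H_plus_def fun_eq_iff)
  obtain lt :: "nat set \<Rightarrow> nat set \<Rightarrow> bool" where lt: "omega1_index lt"
    using Continuum_Hypothesis_imp_omega1_index[OF assms(2)] by blast
  obtain F where F: "full_width_tree (H_plus A) (le_H A) lt F"
    using sigma_closed_forcing.full_width_tree_exists[OF H.sigma_closed_positive[OF lt]] H by auto
  obtain G where "full_width_tree Fin.positive Fin.le_supp lt G"
    using sigma_closed_forcing.full_width_tree_exists[OF Fin.sigma_closed_positive[OF lt]] by blast
  then have "full_width_tree {a :: pow_fin. a \<noteq> bot} (\<le>) lt (\<lambda>s a. abs_pow_fin (G s a))"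
    by (rule full_width_tree_image[where h = abs_pow_fin])
      (simp_all add: abs_pow_fin_image_positive abs_pow_fin_le_iff)
  with F show ?thesis by (rule forcing_equivalent_of_full_width_trees)
qed

end
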